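(* Let $\mathrm{EGD}(\mathbf{P},\boldsymbol\alpha)$ be an $n$-dimensional eventually geometric distribution. (i) For every event $E$, the EGD event semantics agrees with the standard event semantics: $\mathrm{EGD}(\mathbf{P},\boldsymbol\alpha)|^{\mathsf{geo}}_E=\mathrm{EGD}(\mathbf{P},\boldsymbol\alpha)|_E$ as measures on $\mathbb{N}^n$. (ii) For every program $P$, if $\mathrm{EGD}(\mathbf{P},\boldsymbol\alpha)\mathrel{[\![P]\!]^{\mathsf{geo}}}\mathrm{EGD}(\mathbf{Q},\boldsymbol\beta)$ then $[\![P]\!](\mathrm{EGD}(\mathbf{P},\boldsymbol\alpha))\preceq\mathrm{EGD}(\mathbf{Q},\boldsymbol\beta)$. (iii) If, in addition to the hypothesis of (ii), $\mathrm{EGD}(\mathbf{P},\boldsymbol\alpha)$ is a probability distribution, then the normalized distribution is bounded by $$\frac{[\![P]\!]_{\mathsf{lo}}(\mathrm{EGD}(\mathbf{P},\boldsymbol\alpha))|_{\mathbb{N}^n}}{\mathrm{EGD}(\mathbf{Q},\boldsymbol\beta)(\mathbb{N}^n)}\preceq\mathrm{normalize}\big([\![P]\!]_\dagger(\mathrm{EGD}(\mathbf{P},\boldsymbol\alpha))\big)\preceq\frac{\mathrm{EGD}(\mathbf{Q},\boldsymbol\beta)}{[\![P]\!]_{\mathsf{lo}}(\mathrm{EGD}(\mathbf{P},\boldsymbol\alpha))(\mathbb{N}^n)},$$ where each inequality is asserted whenever the quantities in it are defined (i.e. its denominators, including $1-[\![P]\!]_\dagger(\mathrm{EGD}(\mathbf{P},\boldsymbol\alpha))(\{\dagger\})$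 in the normalization, are positive).
   Context: Language. Fix $n$ variables $X_1,\dots,X_n$ with values in $\mathbb{N}=\{0,1,2,\dots\}$. Programs $P$ and events $E$ are given by $P ::= \mathsf{skip} \mid P_1;P_2 \mid X_k := 0 \mid X_k \mathrel{+}= a \mid X_k \mathrel{\dot-}= 1 \mid \mathsf{if}\ E\ \{P_1\}\ \mathsf{else}\ \{P_2\} \mid \mathsf{while}\ E\ \{P_1\} \mid \mathsf{fail}$ and $E ::= X_k = a \mid \mathsf{flip}(\rho) \mid \lnot E_1 \mid E_1 \land E_2$, with literals $a \in \mathbb{N}$, $\rho \in [0,1]$. State space. $\mathbb{N}^n_\dagger := \mathbb{N}^n \cup \{\dagger\}$ where $\dagger$ is a failure state; all $\sigma$-algebras are discrete. For measures, $\mu \preceq \nu$ means $\mu(S)\le\nu(S)$ for all $S$; for measure transformers, $\phi \sqsubseteq \psi$ means $\phi(\mu)\preceq\psi(\mu)$ for all $\mu$. Write $\mu|_\dagger$ and $\mu|_{\mathbb{N}^n}$ for the restrictions of $\mu$ to $\{\dagger\}$ and $\mathbb{N}^n$; $\boldsymbol{x}[k\mapsto v]$ is $\boldsymbol{x}$ with $k$-th entry replaced by $v$; $x \mathbin{\dot-} 1 := \max(x-1,0)$. Measures on $\mathbb{N}^n$ are regarded as measures on $\mathbb{N}^n_\dagger$ with no mass on $\dagger$. Event semantics. $\mu|_{X_k=a}(S) := \mu(\{\boldsymbol{x}\in S\cap\mathbb{N}^n : x_k=a\})$, $\mu|_{\mathsf{flip}(\rho)} := \rho\cdot\mu|_{\mathbb{N}^n}$,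 $\mu|_{\lnot E_1} := \mu|_{\mathbb{N}^n}-\mu|_{E_1}$, $\mu|_{E_1\land E_2} := (\mu|_{E_1})|_{E_2}$. Standard semantics $[\![P]\!]_\dagger : \mathrm{Meas}(\mathbb{N}^n_\dagger)\to\mathrm{Meas}(\mathbb{N}^n_\dagger)$: $[\![\mathsf{skip}]\!]_\dagger(\mu)=\mu$; $[\![P_1;P_2]\!]_\dagger(\mu)=[\![P_2]\!]_\dagger([\![P_1]\!]_\dagger(\mu))$; $[\![X_k:=0]\!]_\dagger(\mu)(S)=\mu|_\dagger(S)+\mu(\{\boldsymbol{x}\in\mathbb{N}^n : \boldsymbol{x}[k\mapsto 0]\in S\})$; $[\![X_k \mathrel{+}= a]\!]_\dagger(\mu)(S)=\mu|_\dagger(S)+\mu(\{\boldsymbol{x}\in\mathbb{N}^n : \boldsymbol{x}[k\mapsto x_k+a]\in S\})$; $[\![X_k \mathrel{\dot-}= 1]\!]_\dagger(\mu)(S)=\mu|_\dagger(S)+\mu(\{\boldsymbol{x}\in\mathbb{N}^n : \boldsymbol{x}[k\mapsto x_k\mathbin{\dot-}1]\in S\})$; $[\![\mathsf{if}\ E\ \{P_1\}\ \mathsf{else}\ \{P_2\}]\!]_\dagger(\mu)=\mu|_\dagger+[\![P_1]\!]_\dagger(\mu|_E)+[\![P_2]\!]_\dagger(\mu|_{\lnot E})$; $[\![\mathsf{fail}]\!]_\dagger(\mu)=\mu(\mathbb{N}^n_\dagger)\cdot\mathrm{Dirac}(\dagger)$; $[\![\mathsf{while}\ E\ \{P_1\}]\!]_\dagger$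 is the least fixed point (w.r.t. $\sqsubseteq$) of $\Phi_{E,P_1}(\psi)(\mu) := \mu|_\dagger+\mu|_{\lnot E}+\psi([\![P_1]\!]_\dagger(\mu|_E))$. Simplified semantics: $[\![P]\!](\mu) := [\![P]\!]_\dagger(\mu)|_{\mathbb{N}^n}$ for $\mu\in\mathrm{Meas}(\mathbb{N}^n)$. Lower bound semantics: $[\![P]\!]_{\mathsf{lo}}$ is defined by the same recursive clauses as $[\![P]\!]_\dagger$ except that $[\![\mathsf{while}\ E\ \{P_1\}]\!]_{\mathsf{lo}}(\mu) := 0$. Normalization: $\mathrm{normalize}(\nu) := \dfrac{\nu-\nu|_\dagger}{1-\nu(\{\dagger\})}$. Tensors and EGDs. $[d] := \{0,\dots,d-1\}$. A tensor $\mathbf{T}\in\mathbb{R}^{[d_1]\times\cdots\times[d_n]}$ (all $d_i\ge1$) has size $|\mathbf{T}|=(d_1,\dots,d_n)$, $|\mathbf{T}|_i=d_i$; $\mathbf{T}_{k:j}$ is the slice with $k$-th index fixed to $j$. Operations $\min,\max,+,-$ and relations $\le,<$ on vectors are componentwise; $\mathbf{0}_n,\mathbf{1}_n$ are the constant vectors; $\boldsymbol\alpha^{\boldsymbol i} := \prod_k\alpha_k^{i_k}$ with $0^0=1$; $[\varphi]$ is $1$ if $\varphi$ holds and $0$ otherwise. For a nonnegative tensor $\mathbf{P}$ and $\boldsymbol\alpha\in[0,1)^n$, $\mathrm{EGD}(\mathbf{P},\boldsymbol\alpha)$ is the measure on $\mathbb{N}^n$ with mass function $\boldsymbol i\mapsto\mathbf{P}_{\min(\boldsymbol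 i,|\mathbf{P}|-\mathbf{1}_n)}\cdot\boldsymbol\alpha^{\max(\boldsymbol i-|\mathbf{P}|+\mathbf{1}_n,\mathbf{0}_n)}$. An expansion of $\mathrm{EGD}(\mathbf{P},\boldsymbol\alpha)$ to a size $\boldsymbol s\ge|\mathbf{P}|$ is $\mathrm{EGD}(\mathbf{P}',\boldsymbol\alpha)$ with $|\mathbf{P}'|=\boldsymbol s$ and $\mathbf{P}'_{\boldsymbol i}=\mathbf{P}_{\min(\boldsymbol i,|\mathbf{P}|-\mathbf{1}_n)}\boldsymbol\alpha^{\max(\boldsymbol i-|\mathbf{P}|+\mathbf{1}_n,\mathbf{0}_n)}$ for $\boldsymbol i<\boldsymbol s$. The relations and operations below act on representations $(\mathbf{P},\boldsymbol\alpha)$, although written with $\mathrm{EGD}(\mathbf{P},\boldsymbol\alpha)$. Order: $\mathrm{EGD}(\mathbf{P},\boldsymbol\alpha)\preceq_{\mathsf{EGD}}\mathrm{EGD}(\mathbf{Q},\boldsymbol\beta)$ iff $\boldsymbol\alpha\le\boldsymbol\beta$ and for all $\boldsymbol i<\max(|\mathbf{P}|,|\mathbf{Q}|)$: $\mathbf{P}_{\min(\boldsymbol i,|\mathbf{P}|-\mathbf{1}_n)}\boldsymbol\alpha^{\max(\boldsymbol i-|\mathbf{P}|+\mathbf{1}_n,\mathbf{0}_n)}\le\mathbf{Q}_{\min(\boldsymbol i,|\mathbf{Q}|-\mathbf{1}_n)}\boldsymbol\beta^{\max(\boldsymbol i-|\mathbf{Q}|+\mathbf{1}_n,\mathbf{0}_n)}$.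 Join: $(\mathrm{EGD}(\mathbf{R},\boldsymbol\gamma),\mathrm{EGD}(\mathbf{S},\boldsymbol\delta),\mathrm{EGD}(\mathbf{Q},\boldsymbol\beta))\in\mathsf{Join}$ iff $\boldsymbol\gamma\le\boldsymbol\beta$, $\boldsymbol\delta\le\boldsymbol\beta$ and there are expansions $\mathrm{EGD}(\mathbf{R}',\boldsymbol\gamma)$, $\mathrm{EGD}(\mathbf{S}',\boldsymbol\delta)$ of the first two, of the same size, with $\mathbf{Q}=\mathbf{R}'+\mathbf{S}'$. Geometric event semantics $\mathrm{EGD}(\mathbf{P},\boldsymbol\alpha)|^{\mathsf{geo}}_E$: for $X_k=a$: $\mathrm{EGD}(\mathbf{Q},\boldsymbol\alpha[k\mapsto0])$ with $|\mathbf{Q}|=|\mathbf{P}|[k\mapsto\max(|\mathbf{P}|_k,a+2)]$, $\mathbf{Q}_{k:j}=\mathbf{P}_{k:\min(j,|\mathbf{P}|_k-1)}\cdot\alpha_k^{\max(0,j-|\mathbf{P}|_k+1)}\cdot[j=a]$; for $\mathsf{flip}(\rho)$: $\mathrm{EGD}(\rho\mathbf{P},\boldsymbol\alpha)$; for $\lnot E_1$: $\mathrm{EGD}(\mathbf{Q},\boldsymbol\alpha)$ where $\mathrm{EGD}(\mathbf{P},\boldsymbol\alpha)|^{\mathsf{geo}}_{E_1}=\mathrm{EGD}(\mathbf{R},\boldsymbol\gamma)$, $|\mathbf{Q}|=|\mathbf{R}|$, $\mathbf{Q}_{\boldsymbol i}=\mathbf{P}_{\min(\boldsymbol i,|\mathbf{P}|-\mathbf{1}_n)}\boldsymbol\alpha^{\max(\boldsymbol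 i-|\mathbf{P}|+\mathbf{1}_n,\mathbf{0}_n)}-\mathbf{R}_{\boldsymbol i}$ for $\boldsymbol i<|\mathbf{Q}|$; for $E_1\land E_2$: $(\mathrm{EGD}(\mathbf{P},\boldsymbol\alpha)|^{\mathsf{geo}}_{E_1})|^{\mathsf{geo}}_{E_2}$. Geometric bound semantics: the relation $\mathrm{EGD}(\mathbf{P},\boldsymbol\alpha)\mathrel{[\![P]\!]^{\mathsf{geo}}}\mathrm{EGD}(\mathbf{Q},\boldsymbol\beta)$ holds iff: - $\mathsf{skip}$: $\boldsymbol\beta=\boldsymbol\alpha$, $\mathbf{Q}=\mathbf{P}$. - $P_1;P_2$: there are $\mathbf{R},\boldsymbol\gamma$ with $\mathrm{EGD}(\mathbf{P},\boldsymbol\alpha)\mathrel{[\![P_1]\!]^{\mathsf{geo}}}\mathrm{EGD}(\mathbf{R},\boldsymbol\gamma)$ and $\mathrm{EGD}(\mathbf{R},\boldsymbol\gamma)\mathrel{[\![P_2]\!]^{\mathsf{geo}}}\mathrm{EGD}(\mathbf{Q},\boldsymbol\beta)$. - $X_k:=0$: $\boldsymbol\beta=\boldsymbol\alpha[k\mapsto0]$, $|\mathbf{Q}|=|\mathbf{P}|[k\mapsto2]$, $\mathbf{Q}_{k:0}=\frac{\mathbf{P}_{k:|\mathbf{P}|_k-1}}{1-\alpha_k}+\sum_{j=0}^{|\mathbf{P}|_k-2}\mathbf{P}_{k:j}$, $\mathbf{Q}_{k:1}=0$. - $X_k\mathrel{+}=a$: $\boldsymbol\beta=\boldsymbol\alpha$,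 $|\mathbf{Q}|=|\mathbf{P}|[k\mapsto|\mathbf{P}|_k+a]$, $\mathbf{Q}_{k:j}=0$ for $j<a$ and $\mathbf{Q}_{k:j}=\mathbf{P}_{k:j-a}$ otherwise. - $X_k\mathrel{\dot-}=1$: $\boldsymbol\beta=\boldsymbol\alpha$, $|\mathbf{Q}|=|\mathbf{P}|[k\mapsto\max(|\mathbf{P}|_k-1,2)]$, $\mathbf{Q}_{k:0}=\mathbf{P}_{k:0}+\mathbf{P}_{k:\min(|\mathbf{P}|_k-1,1)}\alpha_k^{\max(2-|\mathbf{P}|_k,0)}$ and $\mathbf{Q}_{k:j}=\mathbf{P}_{k:\min(|\mathbf{P}|_k-1,j+1)}\alpha_k^{\max(j+2-|\mathbf{P}|_k,0)}$ for $j\ge1$. - $\mathsf{if}\ E\ \{P_1\}\ \mathsf{else}\ \{P_2\}$: there are $\mathbf{R},\mathbf{S},\boldsymbol\gamma,\boldsymbol\delta$ with $\mathrm{EGD}(\mathbf{P},\boldsymbol\alpha)|^{\mathsf{geo}}_E\mathrel{[\![P_1]\!]^{\mathsf{geo}}}\mathrm{EGD}(\mathbf{R},\boldsymbol\gamma)$, $\mathrm{EGD}(\mathbf{P},\boldsymbol\alpha)|^{\mathsf{geo}}_{\lnot E}\mathrel{[\![P_2]\!]^{\mathsf{geo}}}\mathrm{EGD}(\mathbf{S},\boldsymbol\delta)$ and $(\mathrm{EGD}(\mathbf{R},\boldsymbol\gamma),\mathrm{EGD}(\mathbf{S},\boldsymbol\delta),\mathrm{EGD}(\mathbf{Q},\boldsymbol\beta))\in\mathsf{Join}$.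 - $\mathsf{while}\ E\ \{B\}$: there are $c\in[0,1)$, $\mathbf{R},\mathbf{S},\boldsymbol\gamma,\boldsymbol\delta$ with $\mathrm{EGD}(\mathbf{P},\boldsymbol\alpha)\preceq_{\mathsf{EGD}}\mathrm{EGD}(\mathbf{R},\boldsymbol\gamma)$, $\mathrm{EGD}(\mathbf{R},\boldsymbol\gamma)|^{\mathsf{geo}}_E\mathrel{[\![B]\!]^{\mathsf{geo}}}\mathrm{EGD}(\mathbf{S},\boldsymbol\delta)$, $\mathrm{EGD}(\mathbf{S},\boldsymbol\delta)\preceq_{\mathsf{EGD}}\mathrm{EGD}(c\,\mathbf{R},\boldsymbol\gamma)$ and $\mathrm{EGD}(\frac{\mathbf{R}}{1-c},\boldsymbol\gamma)|^{\mathsf{geo}}_{\lnot E}=\mathrm{EGD}(\mathbf{Q},\boldsymbol\beta)$. - $\mathsf{fail}$: $\boldsymbol\beta=\mathbf{0}_n$, $\mathbf{Q}$ is the zero tensor of size $(1,\dots,1)$. *)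

theory Defs
  imports "HOL-Probability.Probability"
begin

section \<open>Programs\<close>

text \<open>The variables of a program are indexed by the type \<open>'n\<close>, which is finite in all results.\<close>

typedef prob = "{0..1::real}"
  morphisms real_of_prob Abs_prob
  by (rule exI[of _ 0]) simp

datatype 'n event =
    VarEq 'n nat
  | Flip prob
  | Neg "'n event"
  | Conj "'n event" "'n event"

datatype 'n prog =
    Skip
  | Seq "'n prog" "'n prog"
  | SetZero 'n
  | Incr 'n nat
  | Decr 'n
  | IfElse "'n event" "'n prog" "'n prog"
  | While "'n event" "'n prog"
  | Fail


section \<open>Discrete measures\<close>

text \<open>
  The failure state is \<open>None\<close>. A discrete measure is a measure \<open>M\<close> with \<open>sets M = UNIV\<close>.
  Only the values of the operations below on discrete measures matter.
\<close>

type_synonym 'n state = "('n \<Rightarrow> nat) option"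

definition discrete_measure :: "('a set \<Rightarrow> ennreal) \<Rightarrow> 'a measure" where
  "discrete_measure f = measure_of UNIV UNIV f"

definition add_measure :: "'a measure \<Rightarrow> 'a measure \<Rightarrow> 'a measure" where
  "add_measure M N = discrete_measure (\<lambda>S. emeasure M S + emeasure N S)"

definition restrict_to :: "'a measure \<Rightarrow> 'a set \<Rightarrow> 'a measure" where
  "restrict_to M A = density M (indicator A)"

abbreviation on_fail :: "'n state measure \<Rightarrow> 'n state measure" where
  "on_fail M \<equiv> restrict_to M {None}"

abbreviation on_nat :: "'n state measure \<Rightarrow> 'n state measure" where
  "on_nat M \<equiv> restrict_to M (range Some)"

text \<open>A measure without failure mass, regarded as a measure on the state space with failure.\<close>

definition emb :: "('n \<Rightarrow> nat) measure \<Rightarrow> 'n state measure" where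
  "emb M = distr M (count_space UNIV) Some"

definition measure_preceq :: "'a measure \<Rightarrow> 'a measure \<Rightarrow> bool" (infix "\<preceq>" 50) where
  "M \<preceq> N \<longleftrightarrow> (\<forall>S. emeasure M S \<le> emeasure N S)"

lemma sets_discrete_measure [simp]: "sets (discrete_measure f) = UNIV"
  by (auto simp: discrete_measure_def sets_measure_of_conv)

lemma emeasure_discrete_measure:
  assumes "f {} = 0" and "countably_additive UNIV f"
  shows "emeasure (discrete_measure f) S = f S"
proof (rule emeasure_measure_of)
  show "discrete_measure f = measure_of UNIV UNIV f"
    by (rule discrete_measure_def)
qed (use assms in \<open>auto simp: positive_def\<close>)

lemma discrete_space: "sets M = UNIV \<Longrightarrow> space M = UNIV"
  using sets_eq_imp_space_eq[of M "count_space UNIV"] by simp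

lemma sets_add_measure [simp]: "sets (add_measure M N) = UNIV"
  by (simp add: add_measure_def)

lemma emeasure_add_measure:
  assumes "sets M = UNIV" "sets N = UNIV"
  shows "emeasure (add_measure M N) S = emeasure M S + emeasure N S"
  unfolding add_measure_def
proof (rule emeasure_discrete_measure)
  show "countably_additive UNIV (\<lambda>S. emeasure M S + emeasure N S)"
  proof (rule countably_additiveI)
    fix A :: "nat \<Rightarrow> 'a set"
    assume A: "disjoint_family A"
    have "(\<Sum>i. emeasure M (A i) + emeasure N (A i)) = (\<Sum>i. emeasure M (A i)) + (\<Sum>i. emeasure N (A i))"
      by (intro suminf_add[symmetric]) auto
    also have "\<dots> = emeasure M (\<Union>i. A i) + emeasure N (\<Union>i. A i)"
      using A assms by (subst (1 2) suminf_emeasure) auto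
    finally show "(\<Sum>i. emeasure M (A i) + emeasure N (A i)) = emeasure M (\<Union>i. A i) + emeasure N (\<Union>i. A i)" .
  qed
qed simp

lemma sets_restrict_to [simp]: "sets (restrict_to M A) = sets M"
  by (simp add: restrict_to_def)

lemma emeasure_restrict_to:
  assumes "sets M = UNIV"
  shows "emeasure (restrict_to M A) S = emeasure M (A \<inter> S)"
  using assms by (simp add: restrict_to_def emeasure_restricted)

lemma sets_emb [simp]: "sets (emb M) = UNIV"
  by (simp add: emb_def)

lemma emeasure_emb:
  assumes "sets M = UNIV"
  shows "emeasure (emb M) S = emeasure M {x. Some x \<in> S}"
proof -
  have "Some \<in> M \<rightarrow>\<^sub>M count_space UNIV"
    using assms by (auto simp: measurable_def)
  then show ?thesis
    using discrete_space[OF assms] by (simp add: emb_def emeasure_distr vimage_def)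
qed

lemma le_measure_iff_preceq:
  assumes "sets M = UNIV" "sets N = UNIV"
  shows "M \<le> N \<longleftrightarrow> M \<preceq> N"
  using assms by (subst le_measure) (auto simp: measure_preceq_def le_fun_def)


section \<open>Semantics\<close>

text \<open>
  The clause for \<open>Neg\<close> subtracts setwise, which gives a measure whenever the measure subtracted is
  finite. This covers all finite \<open>M\<close>, and the semantics maps finite measures to finite measures.
\<close>

primrec restrict_event :: "'n state measure \<Rightarrow> 'n event \<Rightarrow> 'n state measure" where
  "restrict_event M (VarEq k a) = restrict_to M {Some x |x. x k = a}"
| "restrict_event M (Flip \<rho>) = scale_measure (ennreal (real_of_prob \<rho>)) (on_nat M)"
| "restrict_event M (Neg E) = diff_measure (on_nat M) (restrict_event M E)"
| "restrict_event M (Conj E1 E2) = restrict_event (restrict_event M E1) E2"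

definition update_state :: "(('n \<Rightarrow> nat) \<Rightarrow> 'n \<Rightarrow> nat) \<Rightarrow> 'n state measure \<Rightarrow> 'n state measure" where
  "update_state f M =
     discrete_measure (\<lambda>S. emeasure (on_fail M) S + emeasure M {Some x |x. Some (f x) \<in> S})"

definition while_functional ::
    "'n event \<Rightarrow> ('n state measure \<Rightarrow> 'n state measure) \<Rightarrow>
     ('n state measure \<Rightarrow> 'n state measure) \<Rightarrow> 'n state measure \<Rightarrow> 'n state measure" where
  "while_functional E \<phi> \<psi> M =
     add_measure (add_measure (on_fail M) (restrict_event M (Neg E))) (\<psi> (\<phi> (restrict_event M E)))"

text \<open>
  The library order on measures compares the underlying \<open>\<sigma>\<close>-algebras first, so
  \<open>while_functional\<close> is not monotone on transformers with non-discrete values. The \<open>lfp\<close> in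
  \<open>sem_fail\<close> is nevertheless the intended least fixed point; see \<open>sem_fail_While_unfold\<close> and
  \<open>sem_fail_While_least\<close>.
\<close>

primrec sem_fail :: "'n prog \<Rightarrow> 'n state measure \<Rightarrow> 'n state measure" where
  "sem_fail Skip = (\<lambda>M. M)"
| "sem_fail (Seq P1 P2) = (\<lambda>M. sem_fail P2 (sem_fail P1 M))"
| "sem_fail (SetZero k) = update_state (\<lambda>x. x(k := 0))"
| "sem_fail (Incr k a) = update_state (\<lambda>x. x(k := x k + a))"
| "sem_fail (Decr k) = update_state (\<lambda>x. x(k := x k - 1))"
| "sem_fail (IfElse E P1 P2) = (\<lambda>M.
     add_measure (add_measure (on_fail M) (sem_fail P1 (restrict_event M E)))
                 (sem_fail P2 (restrict_event M (Neg E))))"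
| "sem_fail (While E P1) = lfp (while_functional E (sem_fail P1))"
| "sem_fail Fail = (\<lambda>M. scale_measure (emeasure M UNIV) (return (count_space UNIV) None))"

definition sem :: "'n prog \<Rightarrow> ('n \<Rightarrow> nat) measure \<Rightarrow> 'n state measure" where
  "sem P M = on_nat (sem_fail P (emb M))"

primrec sem_lo :: "'n prog \<Rightarrow> 'n state measure \<Rightarrow> 'n state measure" where
  "sem_lo Skip = (\<lambda>M. M)"
| "sem_lo (Seq P1 P2) = (\<lambda>M. sem_lo P2 (sem_lo P1 M))"
| "sem_lo (SetZero k) = update_state (\<lambda>x. x(k := 0))"
| "sem_lo (Incr k a) = update_state (\<lambda>x. x(k := x k + a))"
| "sem_lo (Decr k) = update_state (\<lambda>x. x(k := x k - 1))"
| "sem_lo (IfElse E P1 P2) = (\<lambda>M.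
     add_measure (add_measure (on_fail M) (sem_lo P1 (restrict_event M E)))
                 (sem_lo P2 (restrict_event M (Neg E))))"
| "sem_lo (While E P1) = (\<lambda>M. null_measure (count_space UNIV))"
| "sem_lo Fail = (\<lambda>M. scale_measure (emeasure M UNIV) (return (count_space UNIV) None))"

definition normalize_measure :: "'n state measure \<Rightarrow> 'n state measure" where
  "normalize_measure M = scale_measure (1 / (1 - emeasure M {None})) (diff_measure M (on_fail M))"

lemma sets_restrict_event [simp]: "sets (restrict_event M E) = sets M"
  by (induction E arbitrary: M) simp_all

lemma sets_update_state [simp]: "sets (update_state f M) = UNIV"
  by (simp add: update_state_def)

lemma emeasure_update_state:
  assumes M: "sets M = UNIV"
  shows "emeasure (update_state f M) S =
    emeasure (on_fail M) S + emeasure M {Some x |x. Some (f x) \<in> S}"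
  unfolding update_state_def
proof (rule emeasure_discrete_measure)
  let ?g = "\<lambda>S. {Some x |x. Some (f x) \<in> S}"
  show "countably_additive UNIV (\<lambda>S. emeasure (on_fail M) S + emeasure M (?g S))"
  proof (rule countably_additiveI)
    fix A :: "nat \<Rightarrow> 'a state set"
    assume A: "disjoint_family A"
    then have gA: "disjoint_family (\<lambda>i. ?g (A i))"
      by (fastforce simp: disjoint_family_on_def)
    have "(\<Sum>i. emeasure (on_fail M) (A i) + emeasure M (?g (A i))) =
        (\<Sum>i. emeasure (on_fail M) (A i)) + (\<Sum>i. emeasure M (?g (A i)))"
      by (intro suminf_add[symmetric]) auto
    also have "\<dots> = emeasure (on_fail M) (\<Union>i. A i) + emeasure M (\<Union>i. ?g (A i))"
      using A gA M by (subst (1 2) suminf_emeasure) auto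
    also have "(\<Union>i. ?g (A i)) = ?g (\<Union>i. A i)"
      by auto
    finally show "(\<Sum>i. emeasure (on_fail M) (A i) + emeasure M (?g (A i))) =
        emeasure (on_fail M) (\<Union>i. A i) + emeasure M (?g (\<Union>i. A i))" .
  qed
qed simp

lemma sets_while_functional [simp]: "sets (while_functional E \<phi> \<psi> M) = UNIV"
  by (simp add: while_functional_def)

lemma while_functional_mono:
  assumes "\<psi> \<le> \<psi>'" and disc: "\<And>M. sets (\<psi> M) = UNIV" "\<And>M. sets (\<psi>' M) = UNIV"
  shows "while_functional E \<phi> \<psi> \<le> while_functional E \<phi> \<psi>'"
proof (rule le_funI)
  fix M
  let ?N = "\<phi> (restrict_event M E)"
  let ?A = "add_measure (on_fail M) (restrict_event M (Neg E))"
  have le: "\<psi> ?N \<preceq> \<psi>' ?N"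
    using le_funD[OF assms(1)] le_measure_iff_preceq[OF disc(1) disc(2)] by blast
  have "emeasure (add_measure ?A (\<psi> ?N)) S \<le> emeasure (add_measure ?A (\<psi>' ?N)) S" for S
    unfolding emeasure_add_measure[OF sets_add_measure disc(1)]
      emeasure_add_measure[OF sets_add_measure disc(2)]
    using le unfolding measure_preceq_def by (intro add_left_mono) blast
  then have "while_functional E \<phi> \<psi> M \<preceq> while_functional E \<phi> \<psi>' M"
    unfolding measure_preceq_def while_functional_def by blast
  then show "while_functional E \<phi> \<psi> M \<le> while_functional E \<phi> \<psi>' M"
    unfolding le_measure_iff_preceq[OF sets_while_functional sets_while_functional] .
qed

lemma discrete_above:
  fixes M N :: "'a measure"
  assumes M: "sets M = UNIV" and "M \<le> N"
  shows "sets N = UNIV"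
  using assms(2)
proof cases
  case 1
  then show ?thesis unfolding discrete_space[OF M] by blast
next
  case 2
  then show ?thesis unfolding M by blast
next
  case 3
  then show ?thesis unfolding M by simp
qed

lemma
  fixes \<phi> :: "'n state measure \<Rightarrow> 'n state measure"
  shows sets_lfp_while [simp]: "sets (lfp (while_functional E \<phi>) M) = UNIV"
    and lfp_while_unfold:
      "lfp (while_functional E \<phi>) = while_functional E \<phi> (lfp (while_functional E \<phi>))"
proof -
  let ?F = "while_functional E \<phi>" and ?z = "null_measure (count_space UNIV) :: 'n state measure"
  have z: "sets ?z = UNIV" by simp
  have disc: "sets (u M) = UNIV" if "?F u \<le> u" for u M
    using sets_while_functional le_funD[OF that] by (rule discrete_above)
  have "(\<lambda>_. ?z) \<le> lfp ?F"
  proof (rule lfp_greatest, rule le_funI)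
    fix u M assume u: "?F u \<le> u"
    show "?z \<le> u M"
      unfolding le_measure_iff_preceq[OF z disc[OF u]] by (simp add: measure_preceq_def)
  qed
  then have lfp_disc: "sets (lfp ?F M) = UNIV" for M
    by (intro discrete_above[OF z]) (rule le_funD)
  then show "sets (lfp ?F M) = UNIV" .
  have pre: "?F (lfp ?F) \<le> lfp ?F"
  proof (rule lfp_greatest)
    fix u assume u: "?F u \<le> u"
    have "?F (lfp ?F) \<le> ?F u"
      using lfp_lowerbound[where f = ?F, OF u] lfp_disc disc[OF u] by (rule while_functional_mono)
    then show "?F (lfp ?F) \<le> u"
      using u by (rule order_trans)
  qed
  have "?F (?F (lfp ?F)) \<le> ?F (lfp ?F)"
    using pre sets_while_functional lfp_disc by (rule while_functional_mono)
  then have "lfp ?F \<le> ?F (lfp ?F)"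
    by (rule lfp_lowerbound)
  then show "lfp ?F = ?F (lfp ?F)"
    using pre by (rule antisym)
qed

lemma sets_sem_fail [simp]: "sets M = UNIV \<Longrightarrow> sets (sem_fail P M) = UNIV"
  by (induction P arbitrary: M) simp_all

lemma sem_fail_While_unfold:
  "sem_fail (While E P) = while_functional E (sem_fail P) (sem_fail (While E P))"
  unfolding sem_fail.simps by (rule lfp_while_unfold)

lemma sem_fail_While_least:
  assumes disc: "\<And>M. sets M = UNIV \<Longrightarrow> sets (\<psi> M) = UNIV"
    and pre: "\<And>M. sets M = UNIV \<Longrightarrow> while_functional E (sem_fail P) \<psi> M \<preceq> \<psi> M"
    and M: "sets M = UNIV"
  shows "sem_fail (While E P) M \<preceq> \<psi> M"
proof -
  define \<psi>' where "\<psi>' = (\<lambda>M. if sets M = UNIV then \<psi> M else top)"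
  have \<psi>': "\<psi>' M = \<psi> M" if "sets M = UNIV" for M
    unfolding \<psi>'_def using that by (rule if_P)
  have "while_functional E (sem_fail P) \<psi>' \<le> \<psi>'"
  proof (rule le_funI)
    fix M
    show "while_functional E (sem_fail P) \<psi>' M \<le> \<psi>' M"
    proof (cases "sets M = UNIV")
      case True
      then have "sets (sem_fail P (restrict_event M E)) = UNIV"
        by simp
      then have eq: "while_functional E (sem_fail P) \<psi>' M = while_functional E (sem_fail P) \<psi> M"
        unfolding while_functional_def by (subst \<psi>') auto
      show ?thesis
        unfolding eq \<psi>'[OF True]
        using le_measure_iff_preceq[OF sets_while_functional disc[OF True]] pre[OF True]
        by (rule iffD2)
    next
      case False
      then show ?thesis
        unfolding \<psi>'_def by (simp only: if_False top_greatest)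
    qed
  qed
  then have "lfp (while_functional E (sem_fail P)) \<le> \<psi>'"
    by (rule lfp_lowerbound)
  then have "lfp (while_functional E (sem_fail P)) M \<le> \<psi> M"
    unfolding \<psi>'[OF M, symmetric] by (rule le_funD)
  then show ?thesis
    unfolding sem_fail.simps le_measure_iff_preceq[OF sets_lfp_while disc[OF M]] .
qed


section \<open>Tensors and eventually geometric distributions\<close>

text \<open>
  A tensor is a size vector with an entry function that vanishes outside the index range, so that
  equality of tensors is equality of sizes and of all entries in range.
\<close>

typedef 'n tensor = "{(s :: 'n \<Rightarrow> nat, f :: ('n \<Rightarrow> nat) \<Rightarrow> real).
    (\<forall>k. 1 \<le> s k) \<and> (\<forall>i. \<not> (\<forall>k. i k < s k) \<longrightarrow> f i = 0)}"
  by (rule exI[of _ "(\<lambda>_. 1, \<lambda>_. 0)"]) simp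

definition tsize :: "'n tensor \<Rightarrow> 'n \<Rightarrow> nat" where
  "tsize T = fst (Rep_tensor T)"

definition entry :: "'n tensor \<Rightarrow> ('n \<Rightarrow> nat) \<Rightarrow> real" where
  "entry T = snd (Rep_tensor T)"

text \<open>Meaningful for sizes \<open>s\<close> with \<open>1 \<le> s k\<close> for all \<open>k\<close>.\<close>

definition tensor :: "('n \<Rightarrow> nat) \<Rightarrow> (('n \<Rightarrow> nat) \<Rightarrow> real) \<Rightarrow> 'n tensor" where
  "tensor s f = Abs_tensor (s, \<lambda>i. if \<forall>k. i k < s k then f i else 0)"

definition scale_tensor :: "real \<Rightarrow> 'n tensor \<Rightarrow> 'n tensor" where
  "scale_tensor c T = tensor (tsize T) (\<lambda>i. c * entry T i)"

lemma tsize_ge_1 [simp]: "1 \<le> tsize T k" "Suc 0 \<le> tsize T k" "0 < tsize T k"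
  using Rep_tensor[of T] by (auto simp: tsize_def case_prod_beta Suc_le_eq)

lemma entry_outside: "\<not> (\<forall>k. i k < tsize T k) \<Longrightarrow> entry T i = 0"
  using Rep_tensor[of T] by (auto simp: tsize_def entry_def case_prod_beta)

lemma
  assumes "\<And>k. 1 \<le> s k"
  shows tsize_tensor: "tsize (tensor s f) = s"
    and entry_tensor: "entry (tensor s f) i = (if \<forall>k. i k < s k then f i else 0)"
proof -
  have "Rep_tensor (tensor s f) = (s, \<lambda>i. if \<forall>k. i k < s k then f i else 0)"
    unfolding tensor_def using assms by (intro Abs_tensor_inverse) auto
  then show "tsize (tensor s f) = s" "entry (tensor s f) i = (if \<forall>k. i k < s k then f i else 0)"
    by (simp_all add: tsize_def entry_def)
qed

lemma tensor_eq_iff: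
  "S = T \<longleftrightarrow> tsize S = tsize T \<and> (\<forall>i. (\<forall>k. i k < tsize T k) \<longrightarrow> entry S i = entry T i)"
proof
  assume *: "tsize S = tsize T \<and> (\<forall>i. (\<forall>k. i k < tsize T k) \<longrightarrow> entry S i = entry T i)"
  then have "entry S i = entry T i" for i
    by (cases "\<forall>k. i k < tsize T k") (simp_all add: entry_outside)
  with * show "S = T"
    by (simp add: tsize_def entry_def prod_eq_iff fun_eq_iff flip: Rep_tensor_inject)
qed simp

text \<open>A representation of an eventually geometric distribution, subject to \<open>is_egd\<close>.\<close>

datatype 'n egd = EGD (init_tensor: "'n tensor") (decay: "'n \<Rightarrow> real")

definition is_egd :: "'n egd \<Rightarrow> bool" where
  "is_egd p \<longleftrightarrow> (\<forall>i. 0 \<le> entry (init_tensor p) i) \<and> (\<forall>k. 0 \<le> decay p k \<and> decay p k < 1)"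

text \<open>On \<open>nat\<close>, \<open>i + 1 - s\<close> is the maximum of $i - s + 1$ and $0$.\<close>

fun egd_mass :: "'n egd \<Rightarrow> ('n \<Rightarrow> nat) \<Rightarrow> real" where
  "egd_mass (EGD P \<alpha>) i =
     entry P (\<lambda>k. min (i k) (tsize P k - 1)) * (\<Prod>k\<in>UNIV. \<alpha> k ^ (i k + 1 - tsize P k))"

definition egd_measure :: "'n egd \<Rightarrow> ('n \<Rightarrow> nat) measure" where
  "egd_measure p = point_measure UNIV (\<lambda>i. ennreal (egd_mass p i))"

fun expansion :: "('n \<Rightarrow> nat) \<Rightarrow> 'n egd \<Rightarrow> 'n egd" where
  "expansion s (EGD P \<alpha>) = EGD (tensor s (egd_mass (EGD P \<alpha>))) \<alpha>"

fun egd_le :: "'n egd \<Rightarrow> 'n egd \<Rightarrow> bool" (infix "\<preceq>\<^sub>E\<^sub>G\<^sub>D" 50) where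
  "EGD P \<alpha> \<preceq>\<^sub>E\<^sub>G\<^sub>D EGD Q \<beta> \<longleftrightarrow> (\<forall>k. \<alpha> k \<le> \<beta> k) \<and>
     (\<forall>i. (\<forall>k. i k < max (tsize P k) (tsize Q k)) \<longrightarrow> egd_mass (EGD P \<alpha>) i \<le> egd_mass (EGD Q \<beta>) i)"

fun egd_join :: "'n egd \<Rightarrow> 'n egd \<Rightarrow> 'n egd \<Rightarrow> bool" where
  "egd_join (EGD R \<gamma>) (EGD S \<delta>) (EGD Q \<beta>) \<longleftrightarrow>
     (\<forall>k. \<gamma> k \<le> \<beta> k) \<and> (\<forall>k. \<delta> k \<le> \<beta> k) \<and>
     (\<exists>s R' S'. (\<forall>k. tsize R k \<le> s k) \<and> (\<forall>k. tsize S k \<le> s k) \<and>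
        expansion s (EGD R \<gamma>) = EGD R' \<gamma> \<and> expansion s (EGD S \<delta>) = EGD S' \<delta> \<and>
        Q = tensor s (\<lambda>i. entry R' i + entry S' i))"


section \<open>Geometric bound semantics\<close>

primrec geo_event :: "'n egd \<Rightarrow> 'n event \<Rightarrow> 'n egd" where
  "geo_event p (VarEq k a) = (case p of EGD P \<alpha> \<Rightarrow>
     EGD (tensor ((tsize P)(k := max (tsize P k) (a + 2)))
            (\<lambda>i. entry P (i(k := min (i k) (tsize P k - 1))) * \<alpha> k ^ (i k + 1 - tsize P k) *
                 of_bool (i k = a)))
         (\<alpha>(k := 0)))"
| "geo_event p (Flip \<rho>) = (case p of EGD P \<alpha> \<Rightarrow> EGD (scale_tensor (real_of_prob \<rho>) P) \<alpha>)"
| "geo_event p (Neg E) = (case p of EGD P \<alpha> \<Rightarrow> case geo_event p E of EGD R \<gamma> \<Rightarrow>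
     EGD (tensor (tsize R) (\<lambda>i. egd_mass (EGD P \<alpha>) i - entry R i)) \<alpha>)"
| "geo_event p (Conj E1 E2) = geo_event (geo_event p E1) E2"

text \<open>
  \<open>geo_event\<close> preserves \<open>is_egd\<close>; in particular \<open>Neg\<close> creates no negative entries, which
  \<open>egd_measure\<close> would truncate to \<open>0\<close>.
\<close>

lemma entry_eq_egd_mass:
  assumes "\<And>k. i k < tsize P k"
  shows "entry P i = egd_mass (EGD P \<alpha>) i"
proof -
  have "(\<lambda>k. min (i k) (tsize P k - 1)) = i"
  proof
    show "min (i k) (tsize P k - 1) = i k" for k
      using assms[of k] by simp
  qed
  moreover have "i k + 1 - tsize P k = 0" for k
    using assms[of k] by simp
  ultimately show ?thesis by simp
qed

lemma egd_mass_nonneg: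
  assumes "is_egd p"
  shows "0 \<le> egd_mass p i"
  using assms by (cases p) (auto simp: is_egd_def intro!: mult_nonneg_nonneg prod_nonneg)

lemma egd_mass_beyond:
  fixes P :: "'n::finite tensor"
  assumes "\<And>k. tsize P k \<le> s k"
  shows "egd_mass (EGD P \<alpha>) i =
    egd_mass (EGD P \<alpha>) (\<lambda>k. min (i k) (s k - 1)) * (\<Prod>k\<in>UNIV. \<alpha> k ^ (i k + 1 - s k))"
proof -
  have min: "min (min (i k) (s k - 1)) (tsize P k - 1) = min (i k) (tsize P k - 1)" for k
    using assms[of k] by linarith
  have exp: "\<alpha> k ^ (min (i k) (s k - 1) + 1 - tsize P k) * \<alpha> k ^ (i k + 1 - s k) = \<alpha> k ^ (i k + 1 - tsize P k)" for k
  proof -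
    have "(min (i k) (s k - 1) + 1 - tsize P k) + (i k + 1 - s k) = i k + 1 - tsize P k"
      using assms[of k] tsize_ge_1(1)[of P k] unfolding min_def by (simp split: if_splits; linarith)
    then show ?thesis by (simp flip: power_add)
  qed
  show ?thesis
    by (simp only: egd_mass.simps min mult.assoc flip: prod.distrib) (simp only: exp)
qed

lemma geo_event_invariant:
  fixes p :: "'n::finite egd"
  assumes "is_egd p"
  shows "is_egd (geo_event p E) \<and>
    (\<forall>k. decay (geo_event p E) k \<le> decay p k) \<and>
    (\<forall>k. tsize (init_tensor p) k \<le> tsize (init_tensor (geo_event p E)) k) \<and>
    (\<forall>i. egd_mass (geo_event p E) i \<le> egd_mass p i)"
proof -
  have mass_le: "egd_mass (EGD Q \<beta>) i \<le> egd_mass (EGD P \<alpha>) i"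
    if "is_egd (EGD P \<alpha>)" "\<And>k. 0 \<le> \<beta> k" "\<And>k. \<beta> k \<le> \<alpha> k" "\<And>k. tsize P k \<le> tsize Q k"
      and ent: "\<And>i. (\<And>k. i k < tsize Q k) \<Longrightarrow> entry Q i \<le> egd_mass (EGD P \<alpha>) i"
    for P Q :: "'n tensor" and \<alpha> \<beta> i
  proof -
    have "egd_mass (EGD Q \<beta>) i \<le> egd_mass (EGD P \<alpha>) (\<lambda>k. min (i k) (tsize Q k - 1)) *
        (\<Prod>k\<in>UNIV. \<alpha> k ^ (i k + 1 - tsize Q k))"
      unfolding egd_mass.simps(1)[of Q]
    proof (rule mult_mono)
      have "min (i k) (tsize Q k - 1) < tsize Q k" for k
        using tsize_ge_1(1)[of Q k] by linarith
      then show "entry Q (\<lambda>k. min (i k) (tsize Q k - 1)) \<le>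
          egd_mass (EGD P \<alpha>) (\<lambda>k. min (i k) (tsize Q k - 1))"
        by (rule ent)
    qed (use that in \<open>auto intro!: prod_mono power_mono prod_nonneg egd_mass_nonneg simp del: egd_mass.simps\<close>)
    also have "\<dots> = egd_mass (EGD P \<alpha>) i"
      using that(4) by (rule egd_mass_beyond[symmetric])
    finally show ?thesis .
  qed
  show ?thesis
    using assms
  proof (induction E arbitrary: p)
    case (VarEq k a)
    obtain P \<alpha> where p: "p = EGD P \<alpha>" by (cases p)
    note egd = VarEq[unfolded p is_egd_def, simplified]
    define s where "s = (tsize P)(k := max (tsize P k) (a + 2))"
    define f where "f i = entry P (i(k := min (i k) (tsize P k - 1))) * \<alpha> k ^ (i k + 1 - tsize P k) *
                 of_bool (i k = a)" for i
    have s: "1 \<le> s j" and sP: "tsize P j \<le> s j" for j by (auto simp: s_def)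
    have g: "geo_event p (VarEq k a) = EGD (tensor s f) (\<alpha>(k := 0))"
      by (simp add: p s_def f_def[abs_def])
    have f0: "0 \<le> f i" for i using egd by (simp add: f_def)
    have fle: "f i \<le> egd_mass (EGD P \<alpha>) i" if "\<And>j. i j < s j" for i
    proof -
      have lt: "i j < tsize P j" if "j \<noteq> k" for j
        using \<open>\<And>j. i j < s j\<close>[of j] that by (simp add: s_def)
      then have "(\<lambda>j. min (i j) (tsize P j - 1)) = i(k := min (i k) (tsize P k - 1))"
        by (fastforce simp: fun_eq_iff)
      moreover have "(\<Prod>j\<in>UNIV. \<alpha> j ^ (i j + 1 - tsize P j)) = \<alpha> k ^ (i k + 1 - tsize P k)"
      proof (subst prod.remove[of _ k])
        have "\<alpha> j ^ (i j + 1 - tsize P j) = 1" if "j \<in> UNIV - {k}" for j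
          using lt[of j] that by simp
        then show "\<alpha> k ^ (i k + 1 - tsize P k) * (\<Prod>j\<in>UNIV - {k}. \<alpha> j ^ (i j + 1 - tsize P j)) =
            \<alpha> k ^ (i k + 1 - tsize P k)"
          by (simp only: prod.neutral_const prod.cong mult_1_right)
      qed simp_all
      ultimately show ?thesis using egd by (simp add: f_def)
    qed
    have "is_egd (EGD (tensor s f) (\<alpha>(k := 0)))"
      using egd f0 by (simp add: is_egd_def entry_tensor[OF s])
    moreover have "egd_mass (EGD (tensor s f) (\<alpha>(k := 0))) i \<le> egd_mass (EGD P \<alpha>) i" for i
      by (rule mass_le) (use VarEq egd p sP fle in \<open>auto simp: tsize_tensor[OF s] entry_tensor[OF s] simp del: egd_mass.simps\<close>)
    ultimately show ?case
      unfolding g using egd sP by (simp add: p tsize_tensor[OF s] del: egd_mass.simps)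
  next
    case (Flip \<rho>)
    obtain P \<alpha> where p: "p = EGD P \<alpha>" by (cases p)
    note egd = Flip[unfolded p is_egd_def, simplified]
    have \<rho>: "0 \<le> real_of_prob \<rho>" "real_of_prob \<rho> \<le> 1"
      using real_of_prob[of \<rho>] by auto
    have tsize: "tsize (scale_tensor c P) = tsize P" for c
      by (simp add: scale_tensor_def tsize_tensor)
    have entry: "entry (scale_tensor c P) i = c * entry P i" for c i
      by (simp add: scale_tensor_def entry_tensor entry_outside)
    have "egd_mass (EGD (scale_tensor (real_of_prob \<rho>) P) \<alpha>) i \<le> egd_mass (EGD P \<alpha>) i" for i
      using egd \<rho> by (auto simp: tsize entry intro!: mult_right_mono mult_left_le_one_le prod_nonneg)
    then show ?case
      using egd \<rho> by (simp add: p is_egd_def tsize entry del: egd_mass.simps)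
  next
    case (Neg E)
    obtain P \<alpha> where p: "p = EGD P \<alpha>" by (cases p)
    obtain R \<gamma> where r: "geo_event p E = EGD R \<gamma>" by (cases "geo_event p E")
    note egd = Neg.prems[unfolded p is_egd_def, simplified]
    note IH = Neg.IH[OF Neg.prems, unfolded r, unfolded p egd.sel]
    define f where "f i = egd_mass (EGD P \<alpha>) i - entry R i" for i
    have s: "1 \<le> tsize R k" for k by simp
    have f0: "0 \<le> f i" if "\<And>k. i k < tsize R k" for i
      using IH entry_eq_egd_mass[OF that, of \<gamma>] by (simp add: f_def del: egd_mass.simps)
    have fle: "f i \<le> egd_mass (EGD P \<alpha>) i" for i
      using IH by (simp add: f_def is_egd_def del: egd_mass.simps)
    have g: "geo_event p (Neg E) = EGD (tensor (tsize R) f) \<alpha>"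
      using r by (simp add: p f_def[abs_def] del: egd_mass.simps)
    have "is_egd (EGD (tensor (tsize R) f) \<alpha>)"
      using egd f0 by (simp add: is_egd_def entry_tensor[OF s])
    moreover have "egd_mass (EGD (tensor (tsize R) f) \<alpha>) i \<le> egd_mass (EGD P \<alpha>) i" for i
      by (rule mass_le) (use Neg.prems IH egd p fle in \<open>auto simp: tsize_tensor[OF s] entry_tensor[OF s] simp del: egd_mass.simps\<close>)
    ultimately show ?case
      unfolding g using IH by (simp add: p tsize_tensor[OF s] del: egd_mass.simps)
  next
    case (Conj E1 E2)
    note 1 = Conj.IH(1)[OF Conj.prems]
    note 2 = Conj.IH(2)[OF conjunct1[OF 1]]
    show ?case
      using 1 2 unfolding geo_event.simps by (meson order_trans)
  qed
qed

lemma is_egd_geo_event: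
  fixes p :: "'n::finite egd"
  shows "is_egd p \<Longrightarrow> is_egd (geo_event p E)"
  using geo_event_invariant by blast

primrec geo_sem :: "'n prog \<Rightarrow> 'n egd \<Rightarrow> 'n egd \<Rightarrow> bool" where
  "geo_sem Skip p q \<longleftrightarrow> q = p"
| "geo_sem (Seq C1 C2) p q \<longleftrightarrow> (\<exists>r. is_egd r \<and> geo_sem C1 p r \<and> geo_sem C2 r q)"
| "geo_sem (SetZero k) p q \<longleftrightarrow> (case p of EGD P \<alpha> \<Rightarrow>
     q = EGD (tensor ((tsize P)(k := 2))
               (\<lambda>i. if i k = 0
                    then entry P (i(k := tsize P k - 1)) / (1 - \<alpha> k) +
                         (\<Sum>j<tsize P k - 1. entry P (i(k := j)))
                    else 0))
             (\<alpha>(k := 0)))"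
| "geo_sem (Incr k a) p q \<longleftrightarrow> (case p of EGD P \<alpha> \<Rightarrow>
     q = EGD (tensor ((tsize P)(k := tsize P k + a))
               (\<lambda>i. if i k < a then 0 else entry P (i(k := i k - a))))
             \<alpha>)"
| "geo_sem (Decr k) p q \<longleftrightarrow> (case p of EGD P \<alpha> \<Rightarrow>
     q = EGD (tensor ((tsize P)(k := max (tsize P k - 1) 2))
               (\<lambda>i. if i k = 0
                    then entry P (i(k := 0)) +
                         entry P (i(k := min (tsize P k - 1) 1)) * \<alpha> k ^ (2 - tsize P k)
                    else entry P (i(k := min (tsize P k - 1) (i k + 1))) * \<alpha> k ^ (i k + 2 - tsize P k)))
             \<alpha>)"
| "geo_sem (IfElse E C1 C2) p q \<longleftrightarrow>
     (\<exists>r s. is_egd r \<and> is_egd s \<and> geo_sem C1 (geo_event p E) r \<and> geo_sem C2 (geo_event p (Neg E)) s \<and>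
        egd_join r s q)"
| "geo_sem (While E C) p q \<longleftrightarrow>
     (\<exists>c R \<gamma> s. 0 \<le> c \<and> c < 1 \<and> is_egd (EGD R \<gamma>) \<and> is_egd s \<and>
        p \<preceq>\<^sub>E\<^sub>G\<^sub>D EGD R \<gamma> \<and> geo_sem C (geo_event (EGD R \<gamma>) E) s \<and>
        s \<preceq>\<^sub>E\<^sub>G\<^sub>D EGD (scale_tensor c R) \<gamma> \<and>
        geo_event (EGD (scale_tensor (1 / (1 - c)) R) \<gamma>) (Neg E) = q)"
| "geo_sem Fail p q \<longleftrightarrow> q = EGD (tensor (\<lambda>_. 1) (\<lambda>_. 0)) (\<lambda>_. 0)"

end

theory Submission
  imports Defs
begin

text \<open>
  An event multiplies the mass function by a weight in \<open>[0, 1]\<close>, both for measures and for the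
  geometric representation, which gives (i). For (ii), \<open>M \<le> t * p\<close> implies
  \<open>sem_fail C M \<le> t * q\<close> on the non-failing states, for every factor \<open>t\<close>: a loop is the supremum
  of its finite unrollings, and the invariant \<open>R\<close> with contraction \<open>c\<close> sums to
  \<open>R + c R + c\<^sup>2 R + \<dots> = R / (1 - c)\<close>. The same contraction shows that no mass is lost to
  divergence, so that in (iii) the denominator of the normalization is exactly the mass
  of \<open>sem_fail C \<mu>\<close> on non-failing states, which lies between that of \<open>sem_lo C \<mu>\<close> and that of the bound.
\<close>

section \<open>Discrete measures on a countable type\<close>

text \<open>A measure on a countable type is the sum of its point masses, so comparisons reduce to
  single states. With \<open>'n\<close> finite, \<open>'n state\<close> is countable.\<close>

lemma preceq_pointwise:
  fixes M N :: "'a::countable measure"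
  assumes "sets M = UNIV" "sets N = UNIV" and "\<And>x. emeasure M {x} \<le> emeasure N {x}"
  shows "M \<preceq> N"
  unfolding measure_preceq_def
proof
  fix S
  show "emeasure M S \<le> emeasure N S"
    using assms
    by (subst (1 2) emeasure_countable_singleton) (auto intro: nn_integral_mono uncountable_def)
qed

lemma discrete_eqI:
  fixes M N :: "'a::countable measure"
  assumes "sets M = UNIV" "sets N = UNIV" and "\<And>x. emeasure M {x} = emeasure N {x}"
  shows "M = N"
  using assms by (intro measure_eqI_countable[where A = UNIV]) auto

lemma emeasure_split_fail:
  fixes M :: "'n state measure"
  assumes "sets M = UNIV"
  shows "emeasure M S = emeasure M (S \<inter> {None}) + emeasure M (S \<inter> range Some)"
proof -
  have "(S \<inter> {None}) \<union> (S \<inter> range Some) = S"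
    by (auto simp: notin_range_Some)
  moreover have "emeasure M ((S \<inter> {None}) \<union> (S \<inter> range Some)) =
      emeasure M (S \<inter> {None}) + emeasure M (S \<inter> range Some)"
    using assms by (intro plus_emeasure[symmetric]) auto
  ultimately show ?thesis by simp
qed

lemma finite_measure_discrete:
  assumes "sets M = UNIV" "emeasure M UNIV < \<top>"
  shows "finite_measure M"
  using assms discrete_space[OF assms(1)] by (intro finite_measureI) auto

lemma emeasure_on_nat_UNIV:
  assumes "sets M = UNIV"
  shows "emeasure (on_nat M) UNIV = emeasure M (range Some)"
  using assms by (simp add: emeasure_restrict_to)

section \<open>Events as weights on states\<close>

text \<open>The probability that the event holds in state \<open>x\<close>. Flips are independent,
  hence the product for \<open>Conj\<close>.\<close>

primrec weight :: "'n event \<Rightarrow> ('n \<Rightarrow> nat) \<Rightarrow> real" where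
  "weight (VarEq k a) x = of_bool (x k = a)"
| "weight (Flip \<rho>) x = real_of_prob \<rho>"
| "weight (Neg E) x = 1 - weight E x"
| "weight (Conj E1 E2) x = weight E1 x * weight E2 x"

lemma weight_bounds: "0 \<le> weight E x" "weight E x \<le> 1"
proof (induction E)
  case (Flip \<rho>)
  { case 1 show ?case using real_of_prob[of \<rho>] by simp }
  { case 2 show ?case using real_of_prob[of \<rho>] by simp }
qed (auto simp: mult_le_one)

text \<open>Restriction is multiplication by a density. Finite mass on the non-failing states,
  together with domination, makes the setwise difference in \<open>Neg\<close> a measure.\<close>

lemma
  fixes M :: "('n::finite) state measure"
  assumes "sets M = UNIV" "emeasure M (range Some) < \<top>"
  shows emeasure_restrict_event_None: "emeasure (restrict_event M E) {None} = 0"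
    and emeasure_restrict_event_Some:
      "emeasure (restrict_event M E) {Some x} = ennreal (weight E x) * emeasure M {Some x}"
    and restrict_event_preceq_on_nat: "restrict_event M E \<preceq> on_nat M"
proof -
  \<comment> \<open>Domination follows from the two point formulas alone. It is stated for arbitrary
    \<open>M\<close> and \<open>E\<close> because the induction already needs it for
    subevents.\<close>
  have preceq: "restrict_event M E \<preceq> on_nat M"
    if "sets M = UNIV" "emeasure (restrict_event M E) {None} = 0"
      "\<And>x. emeasure (restrict_event M E) {Some x} = ennreal (weight E x) * emeasure M {Some x}"
    for M :: "'n state measure" and E
  proof (rule preceq_pointwise)
    fix s show "emeasure (restrict_event M E) {s} \<le> emeasure (on_nat M) {s}"
    proof (cases s)
      case (Some x)
      have "ennreal (weight E x) * emeasure M {Some x} \<le> 1 * emeasure M {Some x}"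
        by (intro mult_right_mono) (auto simp: weight_bounds)
      then show ?thesis
        using that Some by (simp add: emeasure_restrict_to)
    qed (use that in simp)
  qed (use that in auto)
  have "emeasure (restrict_event M E) {None} = 0 \<and>
    (\<forall>x. emeasure (restrict_event M E) {Some x} = ennreal (weight E x) * emeasure M {Some x})"
    using assms
  proof (induction E arbitrary: M)
    case (VarEq k a)
    have "{Some x |x. x k = a} \<inter> {Some x} = (if x k = a then {Some x} else {})" for x
      by auto
    then show ?case
      using VarEq by (auto simp: emeasure_restrict_to)
  next
    case (Flip \<rho>)
    have "range Some \<inter> {Some x} = {Some x}" for x :: "'n \<Rightarrow> nat"
      by auto
    then show ?case
      using Flip by (auto simp: emeasure_restrict_to)
  next
    case (Neg E)
    note IH = Neg.IH[OF Neg.prems]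
    have le: "restrict_event M E \<preceq> on_nat M"
      using Neg.prems IH by (intro preceq) auto
    have fin: "finite_measure (on_nat M)"
      using Neg.prems by (intro finite_measure_discrete) (auto simp: emeasure_on_nat_UNIV)
    have fin': "finite_measure (restrict_event M E)"
      using Neg.prems le unfolding measure_preceq_def
      by (intro finite_measure_discrete)
         (auto simp: emeasure_on_nat_UNIV intro: le_less_trans[OF spec[of _ UNIV]])
    have diff: "emeasure (restrict_event M (Neg E)) S =
        emeasure M (range Some \<inter> S) - emeasure (restrict_event M E) S" for S
      unfolding restrict_event.simps
      using le Neg.prems fin fin' by (subst emeasure_diff_measure) (auto simp: measure_preceq_def emeasure_restrict_to)
    have "emeasure M {Some x} - ennreal (weight E x) * emeasure M {Some x} =
        ennreal (1 - weight E x) * emeasure M {Some x}" for x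
    proof -
      \<comment> \<open>Factoring out \<open>1 - weight E x\<close> needs a finite mass:
        \<open>\<top> - \<top>\<close> is \<open>\<top>\<close>, not \<open>0\<close>.\<close>
      have "emeasure M {Some x} < \<top>"
        using Neg.prems by (intro le_less_trans[OF emeasure_mono[of "{Some x}" "range Some"]]) auto
      then obtain r where r: "emeasure M {Some x} = ennreal r" "0 \<le> r"
        by (auto simp: less_top_ennreal)
      have "weight E x * r \<le> r"
        using weight_bounds[of E x] r by (simp add: mult_left_le_one_le)
      then show ?thesis
        using weight_bounds[of E x] r
        by (simp add: ennreal_minus left_diff_distrib flip: ennreal_mult)
    qed
    moreover have "range Some \<inter> {Some x} = {Some x}" for x :: "'n \<Rightarrow> nat"
      by auto
    ultimately show ?case
      by (auto simp: diff IH simp del: restrict_event.simps)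
  next
    case (Conj E1 E2)
    note IH1 = Conj.IH(1)[OF Conj.prems]
    have le: "restrict_event M E1 \<preceq> on_nat M"
      using Conj.prems IH1 by (intro preceq) auto
    have "emeasure (restrict_event M E1) (range Some) \<le> emeasure M (range Some)"
      using le Conj.prems unfolding measure_preceq_def by (metis emeasure_restrict_to inf.idem)
    then have "emeasure (restrict_event M E1) (range Some) < \<top>"
      using Conj.prems(2) by (rule le_less_trans)
    with Conj.prems IH1 Conj.IH(2)[of "restrict_event M E1"] show ?case
      by (simp add: ennreal_mult weight_bounds mult_ac)
  qed
  then show None: "emeasure (restrict_event M E) {None} = 0"
    and Some: "\<And>x. emeasure (restrict_event M E) {Some x} = ennreal (weight E x) * emeasure M {Some x}"
    by auto
  show "restrict_event M E \<preceq> on_nat M"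
    using assms(1) None Some by (rule preceq)
qed

text \<open>The clause for \<open>Neg\<close> subtracts, so monotonicity is not visible from the
  definition. In the weight form each point mass is multiplied by a fixed nonnegative
  factor.\<close>

lemma restrict_event_mono:
  fixes M N :: "('n::finite) state measure"
  assumes "sets M = UNIV" "sets N = UNIV" "M \<preceq> N" "emeasure N (range Some) < \<top>"
  shows "restrict_event M E \<preceq> restrict_event N E"
proof (rule preceq_pointwise)
  have M: "emeasure M (range Some) < \<top>"
    using assms unfolding measure_preceq_def by (meson le_less_trans)
  fix s show "emeasure (restrict_event M E) {s} \<le> emeasure (restrict_event N E) {s}"
    using assms M unfolding measure_preceq_def
    by (cases s)
       (auto simp: emeasure_restrict_event_None emeasure_restrict_event_Some intro!: mult_left_mono)
qed (use assms in auto)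

lemma restrict_event_add_Neg:
  fixes M :: "('n::finite) state measure"
  assumes "sets M = UNIV" "emeasure M (range Some) < \<top>"
  shows "add_measure (restrict_event M E) (restrict_event M (Neg E)) = on_nat M"
proof (rule discrete_eqI)
  fix s show "emeasure (add_measure (restrict_event M E) (restrict_event M (Neg E))) {s} =
      emeasure (on_nat M) {s}"
  proof (cases s)
    case (Some x)
    have "ennreal (weight E x) * a + ennreal (1 - weight E x) * a = a" for a
      using weight_bounds[of E x] by (simp flip: distrib_right ennreal_plus)
    moreover have "range Some \<inter> {Some x} = {Some x}"
      by auto
    ultimately show ?thesis
      using assms Some
      by (simp add: emeasure_add_measure emeasure_restrict_event_Some emeasure_restrict_to del: restrict_event.simps)
  qed (use assms in \<open>simp add: emeasure_add_measure emeasure_restrict_event_None emeasure_restrict_to del: restrict_event.simps\<close>)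
qed (use assms in auto)

text \<open>Conservation of mass at a branch: the weights of \<open>E\<close> and
  \<open>Neg E\<close> sum to 1. Both comparisons of total mass below rest on it.\<close>

lemma emeasure_split_event:
  fixes M :: "('n::finite) state measure"
  assumes "sets M = UNIV" "emeasure M (range Some) < \<top>"
  shows "emeasure M S = emeasure M (S \<inter> {None}) + emeasure (restrict_event M E) S
    + emeasure (restrict_event M (Neg E)) S"
proof -
  have "emeasure (restrict_event M E) S + emeasure (restrict_event M (Neg E)) S = emeasure (on_nat M) S"
    using assms
    by (subst restrict_event_add_Neg[symmetric, where E = E])
      (auto simp: emeasure_add_measure simp del: restrict_event.simps)
  then show ?thesis
    using assms by (subst emeasure_split_fail) (auto simp: emeasure_restrict_to ac_simps simp del: restrict_event.simps)
qed

section \<open>Eventually geometric distributions\<close>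

lemma sets_egd_measure [simp]: "sets (egd_measure p) = UNIV"
  by (simp add: egd_measure_def sets_point_measure)

lemma emeasure_egd_measure_finite_set:
  "finite A \<Longrightarrow> emeasure (egd_measure p) A = (\<Sum>x\<in>A. ennreal (egd_mass p x))"
  by (simp add: egd_measure_def emeasure_point_measure_finite2)

lemma emeasure_egd_measure_singleton:
  "emeasure (egd_measure p) {x} = ennreal (egd_mass p x)"
  by (simp add: emeasure_egd_measure_finite_set)

lemma emeasure_emb_egd_measure:
  "emeasure (emb (egd_measure p)) {Some x} = ennreal (egd_mass p x)"
  "emeasure (emb (egd_measure p)) {None} = 0"
  by (simp_all add: emeasure_emb emeasure_egd_measure_singleton)

text \<open>The mass function is at most a constant times a product, over the finitely many
  coordinates, of eventually geometric sequences with ratios below 1. Such a product of summable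
  sequences is summable over all index vectors.\<close>

lemma emeasure_egd_measure_finite:
  fixes p :: "('n::finite) egd"
  assumes "is_egd p"
  shows "emeasure (egd_measure p) UNIV < \<top>"
proof -
  obtain P \<alpha> where p: "p = EGD P \<alpha>" by (cases p)
  have ent: "0 \<le> entry P i" and \<alpha>: "0 \<le> \<alpha> k" "\<alpha> k < 1" for i k
    using assms by (auto simp: p is_egd_def)
  define I where "I = (PiE UNIV (\<lambda>k. {..<tsize P k}))"
  \<comment> \<open>A crude bound for every entry: a nonnegative entry in the finite box
    \<open>I\<close> is at most the sum, and entries outside the box are \<open>0\<close>.\<close>
  define K where "K = (\<Sum>i\<in>I. entry P i)"
  let ?g = "\<lambda>x :: 'n \<Rightarrow> nat. \<Prod>k\<in>UNIV. \<alpha> k ^ (x k + 1 - tsize P k)"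
  have K0: "0 \<le> K"
    unfolding K_def by (intro sum_nonneg ent)
  have I: "finite I"
    unfolding I_def by (intro finite_PiE) auto
  have K: "entry P i \<le> K" for i
  proof (cases "i \<in> I")
    case True
    then show ?thesis
      unfolding K_def using I ent by (intro member_le_sum) auto
  next
    case False
    then have "entry P i = 0"
      by (intro entry_outside) (auto simp: I_def PiE_UNIV_domain)
    then show ?thesis
      using ent by (simp add: K_def sum_nonneg)
  qed
  \<comment> \<open>The exponent stays \<open>0\<close> up to \<open>n = tsize P k - 1\<close>; from
    \<open>tsize P k\<close> on, the sequence is \<open>\<alpha> k\<close> times a geometric
    one.\<close>
  have "summable (\<lambda>n. \<alpha> k ^ (n + 1 - tsize P k))" for k
  proof -
    have "(\<lambda>n. \<alpha> k ^ (n + tsize P k + 1 - tsize P k)) = (\<lambda>n. \<alpha> k * \<alpha> k ^ n)"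
      by simp
    moreover have "summable (\<lambda>n. \<alpha> k * \<alpha> k ^ n)"
      using \<alpha>[of k] by (intro summable_mult summable_geometric) simp
    ultimately show ?thesis
      by (subst summable_iff_shift[symmetric, of _ "tsize P k"]) (simp only:)
  qed
  then have "Infinite_Set_Sum.abs_summable_on (\<lambda>n. \<alpha> k ^ (n + 1 - tsize P k)) UNIV" for k
    using \<alpha> by (simp add: abs_summable_on_nat_iff')
  then have "Infinite_Set_Sum.abs_summable_on ?g (PiE UNIV (\<lambda>_. UNIV))"
    by (intro abs_summable_on_prod_PiE) auto
  then have g: "Infinite_Set_Sum.abs_summable_on ?g UNIV"
    by (simp add: PiE_UNIV_domain)
  have "emeasure (egd_measure p) UNIV = (\<integral>\<^sup>+x. ennreal (egd_mass p x) \<partial>count_space UNIV)"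
    by (subst emeasure_countable_singleton) (auto simp: emeasure_egd_measure_singleton)
  also have "\<dots> \<le> (\<integral>\<^sup>+x. ennreal K * ennreal (?g x) \<partial>count_space UNIV)"
    using K K0 ent \<alpha>
    by (intro nn_integral_mono)
      (auto simp: p simp flip: ennreal_mult' intro!: ennreal_leI mult_right_mono prod_nonneg)
  also have "\<dots> = ennreal K * ennreal (infsetsum ?g UNIV)"
    using g \<alpha> by (subst nn_integral_cmult) (auto simp: nn_integral_conv_infsetsum prod_nonneg)
  also have "\<dots> < \<top>"
    by (simp add: ennreal_mult_less_top)
  finally show ?thesis .
qed

section \<open>Mass functions along one coordinate\<close>

text \<open>Separates coordinate \<open>k\<close>. The update at \<open>k\<close> changes no value;
  it brings the index into the slice form \<open>i(k := j)\<close> of the clauses for assignments.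
  The remaining product has \<open>1\<close> at \<open>k\<close>, so it is the same for all
  \<open>x\<close> that differ only there.\<close>

lemma egd_mass_split:
  fixes P :: "('n::finite) tensor"
  shows "egd_mass (EGD P \<alpha>) x =
    entry P ((\<lambda>j. min (x j) (tsize P j - 1))(k := min (x k) (tsize P k - 1))) *
      \<alpha> k ^ (x k + 1 - tsize P k) * (\<Prod>j\<in>UNIV. if j = k then 1 else \<alpha> j ^ (x j + 1 - tsize P j))"
proof -
  have "(\<lambda>j. min (x j) (tsize P j - 1))(k := min (x k) (tsize P k - 1)) = (\<lambda>j. min (x j) (tsize P j - 1))"
    by (rule fun_upd_idem) simp
  moreover have "(\<Prod>j\<in>UNIV. if j = k then 1 else \<alpha> j ^ (x j + 1 - tsize P j)) =
      (\<Prod>j\<in>UNIV - {k}. \<alpha> j ^ (x j + 1 - tsize P j))"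
    by (subst prod.remove[of UNIV k]) auto
  ultimately show ?thesis
    by (simp add: prod.remove[of UNIV k] mult.assoc)
qed

lemma egd_mass_tensor_split:
  fixes s :: "('n::finite) \<Rightarrow> nat"
  assumes "\<And>j. 1 \<le> s j"
  shows "egd_mass (EGD (tensor s f) \<alpha>) x =
    f ((\<lambda>j. min (x j) (s j - 1))(k := min (x k) (s k - 1))) *
      \<alpha> k ^ (x k + 1 - s k) * (\<Prod>j\<in>UNIV. if j = k then 1 else \<alpha> j ^ (x j + 1 - s j))"
proof -
  have "min (x j) (s j - 1) < s j" for j
    using assms[of j] by linarith
  then show ?thesis
    using assms by (subst egd_mass_split[where k = k]) (simp add: tsize_tensor entry_tensor cong: if_cong)
qed

lemma scale_tensor_tsize [simp]: "tsize (scale_tensor c P) = tsize P"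
  by (simp add: scale_tensor_def tsize_tensor)

lemma scale_tensor_entry [simp]: "entry (scale_tensor c P) i = c * entry P i"
  by (simp add: scale_tensor_def entry_tensor entry_outside)

lemma egd_mass_scale: "egd_mass (EGD (scale_tensor c P) \<alpha>) x = c * egd_mass (EGD P \<alpha>) x"
  by simp

text \<open>
  The weight of an event is constant beyond the size of the tensor that results from restricting
  to it; this is why \<open>Neg\<close> may subtract the two tensors while keeping the decay rates \<open>\<alpha>\<close>.
\<close>

lemma weight_clip:
  fixes p :: "('n::finite) egd"
  assumes "is_egd p" and "\<And>k. tsize (init_tensor (geo_event p E)) k \<le> s k"
  shows "weight E (\<lambda>k. min (x k) (s k - 1)) = weight E x"
  using assms
proof (induction E arbitrary: p)
  case (VarEq k a)
  obtain P \<alpha> where p: "p = EGD P \<alpha>" by (cases p)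
  \<comment> \<open>Because of the size \<open>a + 2\<close> the clipping index
    \<open>s k - 1\<close> exceeds \<open>a\<close>, so clipping neither moves the value
    \<open>a\<close> nor creates it.\<close>
  have "a + 2 \<le> s k"
    using VarEq.prems(2)[of k] by (simp add: p tsize_tensor le_max_iff_disj)
  then have "min (x k) (s k - 1) = a \<longleftrightarrow> x k = a"
    by linarith
  then show ?case by simp
next
  case (Neg E)
  then show ?case
    by (cases p, cases "geo_event p E") (force simp: tsize_tensor)
next
  case (Conj E1 E2)
  \<comment> \<open>Sizes never shrink under \<open>geo_event\<close>, so a size vector above the
    final tensor is also above the intermediate one.\<close>
  have "tsize (init_tensor (geo_event p E1)) k \<le> s k" for k
    using geo_event_invariant[OF is_egd_geo_event[OF Conj.prems(1), of E1], of E2] Conj.prems(2)[of k]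
    by (auto intro: order_trans)
  then show ?case
    using Conj.IH(1)[of p] Conj.IH(2)[of "geo_event p E1"] Conj.prems
    by (simp add: is_egd_geo_event)
qed simp

text \<open>Counterpart of \<open>emeasure_restrict_event_Some\<close> for representations; together
  they give (i).\<close>

lemma egd_mass_geo_event:
  fixes p :: "('n::finite) egd"
  assumes "is_egd p"
  shows "egd_mass (geo_event p E) x = weight E x * egd_mass p x"
  using assms
proof (induction E arbitrary: p x)
  case (VarEq k a)
  obtain P \<alpha> where p: "p = EGD P \<alpha>" by (cases p)
  let ?s = "(tsize P)(k := max (tsize P k) (a + 2))"
  have s: "1 \<le> ?s j" for j by (simp add: le_max_iff_disj)
  have min: "min (x k) (max (tsize P k) (a + 2) - 1) = a \<longleftrightarrow> x k = a"
    by linarith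
  show ?case
  proof (cases "x k = a")
    case True
    \<comment> \<open>\<open>a\<close> lies below the last index of the new tensor, so the new rate
      \<open>0\<close> has exponent \<open>0\<close> and contributes
      \<open>0 ^ 0 = 1\<close>.\<close>
    then have "min (x k) (max (tsize P k) (a + 2) - 1) = x k" "x k + 1 - max (tsize P k) (a + 2) = 0"
      by linarith+
    then show ?thesis
      using True
      unfolding p geo_event.simps egd.case egd_mass_tensor_split[OF s, where k = k]
        egd_mass_split[of P \<alpha> x k]
      by (simp add: fun_upd_def cong: if_cong)
  next
    case False
    then show ?thesis
      using min unfolding p geo_event.simps egd.case egd_mass_tensor_split[OF s, where k = k] by simp
  qed
next
  case (Flip \<rho>)
  then show ?case
    by (cases p) simp
next
  case (Neg E)
  obtain P \<alpha> where p: "p = EGD P \<alpha>" by (cases p)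
  obtain R \<gamma> where r: "geo_event p E = EGD R \<gamma>" by (cases "geo_event p E")
  let ?c = "\<lambda>k. min (x k) (tsize R k - 1)"
  have c: "?c k < tsize R k" for k
    using tsize_ge_1(1)[of R k] by linarith
  have le: "tsize P k \<le> tsize R k" for k
    using geo_event_invariant[OF Neg.prems, of E] by (simp add: p r[unfolded p])
  \<comment> \<open>Everything is read at the clipped index \<open>?c\<close>, where
    \<open>R\<close> holds \<open>weight E ?c\<close> times the mass of \<open>p\<close>. Clipping
    preserves the weight, so \<open>1 - weight E x\<close> factors out, and \<open>p\<close>
    continues from \<open>?c\<close> with the rates \<open>\<alpha>\<close>.\<close>
  have "egd_mass (geo_event p (Neg E)) x =
      (egd_mass p ?c - entry R ?c) * (\<Prod>k\<in>UNIV. \<alpha> k ^ (x k + 1 - tsize R k))"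
    using c by (simp add: p r[unfolded p] tsize_tensor entry_tensor)
  also have "entry R ?c = weight E ?c * egd_mass p ?c"
    using entry_eq_egd_mass[of ?c R \<gamma>] c Neg.IH[OF Neg.prems, of ?c] by (simp add: r del: egd_mass.simps)
  also have "weight E ?c = weight E x"
    using Neg.prems by (intro weight_clip[of p]) (auto simp: r)
  also have "(egd_mass p ?c - weight E x * egd_mass p ?c) * (\<Prod>k\<in>UNIV. \<alpha> k ^ (x k + 1 - tsize R k)) =
      weight (Neg E) x * (egd_mass p ?c * (\<Prod>k\<in>UNIV. \<alpha> k ^ (x k + 1 - tsize R k)))"
    by (simp add: algebra_simps)
  also have "egd_mass p ?c * (\<Prod>k\<in>UNIV. \<alpha> k ^ (x k + 1 - tsize R k)) = egd_mass p x"
    unfolding p using le by (rule egd_mass_beyond[symmetric])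
  finally show ?case .
next
  case (Conj E1 E2)
  then show ?case
    by (simp add: is_egd_geo_event)
qed

section \<open>Order and join beyond the tensors\<close>

text \<open>The order is tested only inside the common box. Outside it, each mass is that at the
  clipped index times powers of the decay rates, and \<open>\<alpha> \<le> \<beta>\<close> orders
  these.\<close>

lemma egd_le_mass:
  fixes p q :: "('n::finite) egd"
  assumes "is_egd p" and "p \<preceq>\<^sub>E\<^sub>G\<^sub>D q"
  shows "egd_mass p x \<le> egd_mass q x"
proof -
  obtain P \<alpha> where p: "p = EGD P \<alpha>" by (cases p)
  obtain Q \<beta> where q: "q = EGD Q \<beta>" by (cases q)
  let ?s = "\<lambda>k. max (tsize P k) (tsize Q k)"
  let ?c = "\<lambda>k. min (x k) (?s k - 1)"
  have \<alpha>: "0 \<le> \<alpha> k" "\<alpha> k \<le> \<beta> k" for k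
    using assms by (auto simp: p q is_egd_def)
  have "?c k < ?s k" for k
    using tsize_ge_1(1)[of P k] by linarith
  then have c: "egd_mass p ?c \<le> egd_mass q ?c"
    using assms(2) unfolding p q egd_le.simps by (elim conjE allE[of _ ?c] impE) auto
  have "egd_mass p x = egd_mass p ?c * (\<Prod>k\<in>UNIV. \<alpha> k ^ (x k + 1 - ?s k))"
    unfolding p by (rule egd_mass_beyond) simp
  also have "\<dots> \<le> egd_mass q ?c * (\<Prod>k\<in>UNIV. \<beta> k ^ (x k + 1 - ?s k))"
    using c \<alpha> egd_mass_nonneg[OF assms(1), of ?c]
    by (intro mult_mono prod_mono) (auto intro!: power_mono prod_nonneg)
  also have "\<dots> = egd_mass q x"
    unfolding q by (rule egd_mass_beyond[symmetric]) simp
  finally show ?thesis .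
qed

text \<open>Only an inequality: beyond the common size \<open>d\<close> the summands decay at their
  own rates, which are enlarged to the rates \<open>\<beta>\<close> of the join.\<close>

lemma egd_join_mass:
  fixes r s q :: "('n::finite) egd"
  assumes "is_egd r" "is_egd s" and "egd_join r s q"
  shows "egd_mass r x + egd_mass s x \<le> egd_mass q x"
proof -
  obtain R \<gamma> where r: "r = EGD R \<gamma>" by (cases r)
  obtain S \<delta> where s: "s = EGD S \<delta>" by (cases s)
  obtain Q \<beta> where q: "q = EGD Q \<beta>" by (cases q)
  from assms(3) obtain d where d: "\<And>k. tsize R k \<le> d k" "\<And>k. tsize S k \<le> d k"
    and Q: "Q = tensor d (\<lambda>i. entry (tensor d (egd_mass r)) i + entry (tensor d (egd_mass s)) i)"
    and le: "\<And>k. \<gamma> k \<le> \<beta> k" "\<And>k. \<delta> k \<le> \<beta> k"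
    by (auto simp: r s q)
  let ?c = "\<lambda>k. min (x k) (d k - 1)"
  have d1: "1 \<le> d k" for k
    using d(1)[of k] tsize_ge_1(1)[of R k] by linarith
  then have c: "?c k < d k" for k
    using d1[of k] by linarith
  have nonneg: "0 \<le> \<gamma> k" "0 \<le> \<delta> k" for k
    using assms(1,2) by (auto simp: r s is_egd_def)
  have le': "egd_mass r x \<le> egd_mass r ?c * (\<Prod>k\<in>UNIV. \<beta> k ^ (x k + 1 - d k))"
    using d(1) le(1) nonneg(1) assms(1) unfolding r
    by (subst egd_mass_beyond[of R d]) (auto intro!: mult_left_mono prod_mono power_mono egd_mass_nonneg simp del: egd_mass.simps)
  have "egd_mass s x \<le> egd_mass s ?c * (\<Prod>k\<in>UNIV. \<beta> k ^ (x k + 1 - d k))"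
    using d(2) le(2) nonneg(2) assms(2) unfolding s
    by (subst egd_mass_beyond[of S d]) (auto intro!: mult_left_mono prod_mono power_mono egd_mass_nonneg simp del: egd_mass.simps)
  with le' have "egd_mass r x + egd_mass s x \<le>
      (egd_mass r ?c + egd_mass s ?c) * (\<Prod>k\<in>UNIV. \<beta> k ^ (x k + 1 - d k))"
    by (simp add: distrib_right)
  also have "\<dots> = egd_mass q x"
    using c d1 by (simp add: q Q tsize_tensor entry_tensor)
  finally show ?thesis .
qed

section \<open>Assignments as image measures\<close>

text \<open>The clauses for assignments are exact: the new mass at \<open>y\<close> is the old mass
  of the preimage of \<open>y\<close>. Adding \<open>a\<close> is injective, so here the preimage is
  empty or a single point.\<close>

lemma geo_sem_Incr_mass:
  fixes p :: "('n::finite) egd"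
  assumes "geo_sem (Incr k a) p q" "is_egd p"
  shows "emeasure (egd_measure p) {x. x(k := x k + a) = y} = ennreal (egd_mass q y)"
proof -
  obtain P \<alpha> where p: "p = EGD P \<alpha>" by (cases p)
  let ?s = "(tsize P)(k := tsize P k + a)"
  let ?f = "\<lambda>i. if i k < a then 0 else entry P (i(k := i k - a))"
  have s: "1 \<le> ?s j" for j by (auto simp: trans_le_add1)
  have q: "q = EGD (tensor ?s ?f) \<alpha>"
    using assms by (simp add: p)
  show ?thesis
  proof (cases "y k < a")
    case True
    then have "{x. x(k := x k + a) = y} = {}"
      by auto
    moreover have "min (y k) (tsize P k + a - 1) < a"
      using True by linarith
    then have "egd_mass q y = 0"
      unfolding q egd_mass_tensor_split[OF s, where k = k] by simp
    ultimately show ?thesis by simp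
  next
    case False
    then obtain z where z: "y k = z + a"
      by (metis add.commute le_Suc_ex not_le)
    then have "x(k := x k + a) = y \<longleftrightarrow> x = y(k := z)" for x
      by (auto simp: fun_eq_iff)
    then have "{x. x(k := x k + a) = y} = {y(k := z)}"
      by auto
    moreover have "egd_mass q y = egd_mass p (y(k := z))"
    proof -
      \<comment> \<open>Clipping at the enlarged size and shifting back by \<open>a\<close> is
        clipping \<open>z\<close> at the original size.\<close>
      have "min (z + a) (tsize P k + a - 1) - a = min z (tsize P k - 1)"
        "\<not> min (z + a) (tsize P k + a - 1) < a"
        using tsize_ge_1(1)[of P k] by linarith+
      then show ?thesis
        unfolding p q egd_mass_tensor_split[OF s, where k = k]
          egd_mass_split[of P \<alpha> "y(k := z)" k]
        by (simp add: z fun_upd_def cong: if_cong)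
    qed
    ultimately show ?thesis
      by (simp add: emeasure_egd_measure_singleton)
  qed
qed

text \<open>Truncation at \<open>0\<close> merges the values \<open>0\<close> and \<open>1\<close>;
  a \<open>y\<close> with \<open>y k > 0\<close> has one preimage. The new size is at least 2 so
  that the merged entry at \<open>0\<close> is not continued by the geometric tail.\<close>

lemma geo_sem_Decr_mass:
  fixes p :: "('n::finite) egd"
  assumes "geo_sem (Decr k) p q" "is_egd p"
  shows "emeasure (egd_measure p) {x. x(k := x k - 1) = y} = ennreal (egd_mass q y)"
proof -
  obtain P \<alpha> where p: "p = EGD P \<alpha>" by (cases p)
  define d where "d = tsize P k"
  have d: "1 \<le> d" by (simp add: d_def)
  let ?s = "(tsize P)(k := max (d - 1) 2)"
  let ?f = "\<lambda>i. if i k = 0 then entry P (i(k := 0)) + entry P (i(k := min (d - 1) 1)) * \<alpha> k ^ (2 - d)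
                else entry P (i(k := min (d - 1) (i k + 1))) * \<alpha> k ^ (i k + 2 - d)"
  have s: "1 \<le> ?s j" for j by auto
  have q: "q = EGD (tensor ?s ?f) \<alpha>"
    using assms unfolding p d_def by simp
  have mass_p: "egd_mass p (y(k := v)) =
      entry P ((\<lambda>j. min (y j) (tsize P j - 1))(k := min v (d - 1))) *
      \<alpha> k ^ (v + 1 - d) * (\<Prod>j\<in>UNIV. if j = k then 1 else \<alpha> j ^ (y j + 1 - tsize P j))" for v
    unfolding p d_def egd_mass_split[of P \<alpha> _ k] by (simp add: fun_upd_def cong: if_cong)
  have mass_q: "egd_mass q y =
      ?f ((\<lambda>j. min (y j) (tsize P j - 1))(k := min (y k) (max (d - 1) 2 - 1))) *
      \<alpha> k ^ (y k + 1 - max (d - 1) 2) * (\<Prod>j\<in>UNIV. if j = k then 1 else \<alpha> j ^ (y j + 1 - tsize P j))"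
    unfolding q egd_mass_tensor_split[OF s, where k = k] by (simp add: fun_upd_def cong: if_cong)
  show ?thesis
  proof (cases "y k = 0")
    case True
    then have "x(k := x k - 1) = y \<longleftrightarrow> x = y(k := 0) \<or> x = y(k := 1)" for x
      by (auto simp: fun_eq_iff)
    then have "{x. x(k := x k - 1) = y} = {y(k := 0), y(k := 1)}"
      by auto
    moreover have "y(k := 0) \<noteq> y(k := 1)"
      by (auto dest: fun_cong[of _ _ k])
    ultimately have "emeasure (egd_measure p) {x. x(k := x k - 1) = y} =
        ennreal (egd_mass p (y(k := 0))) + ennreal (egd_mass p (y(k := 1)))"
      by (simp add: emeasure_egd_measure_finite_set)
    also have "\<dots> = ennreal (egd_mass p (y(k := 0)) + egd_mass p (y(k := 1)))"
      using assms by (simp add: egd_mass_nonneg)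
    also have "egd_mass p (y(k := 0)) + egd_mass p (y(k := 1)) = egd_mass q y"
      unfolding mass_p mass_q using True d
      by (simp add: distrib_right min.commute numeral_2_eq_2 Suc_diff_le le_Suc_eq max_def)
    finally show ?thesis .
  next
    case False
    then have "x(k := x k - 1) = y \<longleftrightarrow> x = y(k := y k + 1)" for x
      by (auto simp: fun_eq_iff)
    then have "{x. x(k := x k - 1) = y} = {y(k := y k + 1)}"
      by auto
    moreover have "egd_mass q y = egd_mass p (y(k := y k + 1))"
    proof -
      \<comment> \<open>\<open>?m\<close> is the clipped index of \<open>y\<close>. It is positive
        because the new size is at least 2, so the second branch of \<open>?f\<close> applies. Its
        exponent and that of the decay add up to the exponent of \<open>y k + 1\<close> in
        \<open>p\<close>.\<close>
      let ?m = "min (y k) (max (d - 1) 2 - 1)"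
      have m: "?m \<noteq> 0" "min (d - 1) (?m + 1) = min (y k + 1) (d - 1)"
        and "(?m + 2 - d) + (y k + 1 - max (d - 1) 2) = y k + 1 + 1 - d"
        using False d by (auto simp: min_def max_def)
      then have "\<alpha> k ^ (?m + 2 - d) * \<alpha> k ^ (y k + 1 - max (d - 1) 2) = \<alpha> k ^ (y k + 1 + 1 - d)"
        by (simp only: flip: power_add)
      then show ?thesis
        unfolding mass_p mass_q using m(1)
        by (simp only: fun_upd_same fun_upd_upd m(2) if_False mult.assoc flip: mult.assoc[of "\<alpha> k ^ _" "\<alpha> k ^ _"])
    qed
    ultimately show ?thesis
      by (simp add: emeasure_egd_measure_singleton)
  qed
qed

text \<open>All values of coordinate \<open>k\<close> collapse to \<open>0\<close>, so the new mass
  is a series: the first \<open>d - 1\<close> slices enter one by one, and the last slice starts a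
  geometric series of ratio \<open>\<alpha> k\<close>.\<close>

lemma geo_sem_SetZero_mass:
  fixes p :: "('n::finite) egd"
  assumes "geo_sem (SetZero k) p q" "is_egd p"
  shows "emeasure (egd_measure p) {x. x(k := 0) = y} = ennreal (egd_mass q y)"
proof -
  obtain P \<alpha> where p: "p = EGD P \<alpha>" by (cases p)
  define d where "d = tsize P k"
  have d: "1 \<le> d" by (simp add: d_def)
  let ?s = "(tsize P)(k := 2)"
  let ?f = "\<lambda>i. if i k = 0 then entry P (i(k := d - 1)) / (1 - \<alpha> k) + (\<Sum>j<d - 1. entry P (i(k := j)))
                else 0"
  have s: "1 \<le> ?s j" for j by auto
  have q: "q = EGD (tensor ?s ?f) (\<alpha>(k := 0))"
    using assms unfolding p d_def by simp
  have \<alpha>: "0 \<le> \<alpha> k" "\<alpha> k < 1"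
    using assms by (auto simp: p is_egd_def)
  let ?c = "\<lambda>j. min (y j) (tsize P j - 1)"
  let ?rest = "\<Prod>j\<in>UNIV. if j = k then 1 else \<alpha> j ^ (y j + 1 - tsize P j)"
  have mass_p: "egd_mass p (y(k := v)) = entry P (?c(k := min v (d - 1))) * \<alpha> k ^ (v + 1 - d) * ?rest" for v
    unfolding p d_def egd_mass_split[of P \<alpha> _ k] by (simp add: fun_upd_def cong: if_cong)
  \<comment> \<open>The exponent \<open>y k + 1 - 2\<close> of the rate \<open>0\<close> is
    truncated, so at \<open>y k = 0\<close> the factor is \<open>0 ^ 0 = 1\<close>. For positive
    \<open>y k\<close> the zero slice at index \<open>1\<close> is read.\<close>
  have mass_q: "egd_mass q y =
      ?f (?c(k := min (y k) 1)) * 0 ^ (y k - 1) * ?rest"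
    unfolding q egd_mass_tensor_split[OF s, where k = k] by (simp add: fun_upd_def cong: if_cong)
  show ?thesis
  proof (cases "y k = 0")
    case True
    have "x(k := 0) = y \<longleftrightarrow> (\<exists>v. x = y(k := v))" for x
      using True by (auto simp: fun_eq_iff)
    then have "{x. x(k := 0) = y} = (\<Union>v. {y(k := v)})"
      by auto
    moreover have "disjoint_family (\<lambda>v. {y(k := v)})"
      by (auto simp: disjoint_family_on_def dest: fun_cong[of _ _ k])
    ultimately have "emeasure (egd_measure p) {x. x(k := 0) = y} = (\<Sum>v. ennreal (egd_mass p (y(k := v))))"
      by (simp add: suminf_emeasure[symmetric] emeasure_egd_measure_singleton)
    also have "\<dots> = ennreal (egd_mass q y)"
    proof (rule suminf_ennreal_eq)
      \<comment> \<open>The tail first: at \<open>v + (d - 1)\<close> the index is clipped to the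
        last slice and the exponent is exactly \<open>v\<close>. Shifting back adds the first
        \<open>d - 1\<close> terms, all of exponent \<open>0\<close>.\<close>
      have "(\<lambda>v. entry P (?c(k := d - 1)) * \<alpha> k ^ v) sums (entry P (?c(k := d - 1)) * (1 / (1 - \<alpha> k)))"
        using \<alpha> by (intro sums_mult geometric_sums) simp
      also have "(\<lambda>v. entry P (?c(k := d - 1)) * \<alpha> k ^ v) =
          (\<lambda>v. entry P (?c(k := min (v + (d - 1)) (d - 1))) * \<alpha> k ^ (v + (d - 1) + 1 - d))"
      proof -
        have "min (v + (d - 1)) (d - 1) = d - 1" "v + (d - 1) + 1 - d = v" for v
          using d by linarith+
        then show ?thesis by (simp only:)
      qed
      finally have "(\<lambda>v. entry P (?c(k := min v (d - 1))) * \<alpha> k ^ (v + 1 - d)) sums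
          (entry P (?c(k := d - 1)) * (1 / (1 - \<alpha> k)) +
           (\<Sum>v<d - 1. entry P (?c(k := min v (d - 1))) * \<alpha> k ^ (v + 1 - d)))"
        by (subst (asm) sums_iff_shift) simp
      also have "(\<Sum>v<d - 1. entry P (?c(k := min v (d - 1))) * \<alpha> k ^ (v + 1 - d)) =
          (\<Sum>v<d - 1. entry P (?c(k := v)))"
        by (intro sum.cong) auto
      finally have "(\<lambda>v. egd_mass p (y(k := v))) sums
         ((entry P (?c(k := d - 1)) * (1 / (1 - \<alpha> k)) + (\<Sum>v<d - 1. entry P (?c(k := v)))) * ?rest)"
        unfolding mass_p by (rule sums_mult2)
      then show "(\<lambda>v. egd_mass p (y(k := v))) sums egd_mass q y"
        unfolding mass_q using True by simp
    qed (use assms in \<open>simp add: egd_mass_nonneg\<close>)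
    finally show ?thesis .
  next
    case False
    then have "{x. x(k := 0) = y} = {}"
      by auto
    moreover have "egd_mass q y = 0"
      unfolding mass_q using False by simp
    ultimately show ?thesis by simp
  qed
qed

section \<open>Semantics\<close>

lemma sets_sem_lo [simp]: "sets M = UNIV \<Longrightarrow> sets (sem_lo P M) = UNIV"
  by (induction P arbitrary: M) simp_all

lemma emeasure_restrict_event_finite:
  fixes M :: "('n::finite) state measure"
  assumes "sets M = UNIV" "emeasure M (range Some) < \<top>"
  shows "emeasure (restrict_event M E) S < \<top>"
proof -
  have "emeasure (restrict_event M E) S \<le> emeasure M (range Some \<inter> S)"
    using restrict_event_preceq_on_nat[OF assms, of E] assms
    by (simp add: measure_preceq_def emeasure_restrict_to)
  also have "\<dots> \<le> emeasure M (range Some)"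
    using assms by (intro emeasure_mono) auto
  finally show ?thesis
    using assms(2) by (rule le_less_trans)
qed

lemma emeasure_range_Some_finite:
  fixes M :: "'n state measure"
  assumes "sets M = UNIV" "emeasure M UNIV < \<top>"
  shows "emeasure M (range Some) < \<top>"
  using assms by (auto intro: le_less_trans[OF emeasure_mono[of "range Some" UNIV M]])

lemma emeasure_while_functional:
  assumes "sets M = UNIV" "sets (\<psi> (\<phi> (restrict_event M E))) = UNIV"
  shows "emeasure (while_functional E \<phi> \<psi> M) S =
    emeasure M (S \<inter> {None}) + emeasure (restrict_event M (Neg E)) S
      + emeasure (\<psi> (\<phi> (restrict_event M E))) S"
  using assms
  by (simp add: while_functional_def emeasure_add_measure emeasure_restrict_to Int_commute
      del: restrict_event.simps)

lemma emeasure_sem_fail_IfElse: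
  assumes "sets M = UNIV"
  shows "emeasure (sem_fail (IfElse E P1 P2) M) S =
    emeasure M (S \<inter> {None}) + emeasure (sem_fail P1 (restrict_event M E)) S
      + emeasure (sem_fail P2 (restrict_event M (Neg E))) S"
  using assms
  by (simp add: emeasure_add_measure emeasure_restrict_to Int_commute del: restrict_event.simps)

lemma emeasure_sem_lo_IfElse:
  assumes "sets M = UNIV"
  shows "emeasure (sem_lo (IfElse E P1 P2) M) S =
    emeasure M (S \<inter> {None}) + emeasure (sem_lo P1 (restrict_event M E)) S
      + emeasure (sem_lo P2 (restrict_event M (Neg E))) S"
  using assms
  by (simp add: emeasure_add_measure emeasure_restrict_to Int_commute del: restrict_event.simps)

section \<open>Loops as limits of unrollings\<close>

text \<open>Iterates of the loop functional from the zero measure: the output of runs that execute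
  the body fewer than \<open>k\<close> times.\<close>

primrec while_iter :: "'n event \<Rightarrow> 'n prog \<Rightarrow> nat \<Rightarrow> 'n state measure \<Rightarrow> 'n state measure" where
  "while_iter E P 0 = (\<lambda>M. null_measure (count_space UNIV))"
| "while_iter E P (Suc k) = while_functional E (sem_fail P) (while_iter E P k)"

lemma sets_while_iter [simp]: "sets (while_iter E P k M) = UNIV"
  by (cases k) simp_all

lemma emeasure_while_iter_Suc:
  assumes "sets M = UNIV"
  shows "emeasure (while_iter E P (Suc k) M) S =
    emeasure M (S \<inter> {None}) + emeasure (restrict_event M (Neg E)) S
      + emeasure (while_iter E P k (sem_fail P (restrict_event M E))) S"
  using assms by (simp add: emeasure_while_functional del: restrict_event.simps)

lemma emeasure_sem_fail_While:
  assumes "sets M = UNIV"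
  shows "emeasure (sem_fail (While E P) M) S =
    emeasure M (S \<inter> {None}) + emeasure (restrict_event M (Neg E)) S
      + emeasure (sem_fail (While E P) (sem_fail P (restrict_event M E))) S"
  using assms
  by (subst sem_fail_While_unfold) (subst emeasure_while_functional, simp_all del: restrict_event.simps)

lemma while_iter_preceq_sem_fail:
  "sets M = UNIV \<Longrightarrow> emeasure (while_iter E P k M) S \<le> emeasure (sem_fail (While E P) M) S"
proof (induction k arbitrary: M)
  case (Suc k)
  then show ?case
    unfolding emeasure_while_iter_Suc[OF Suc.prems] emeasure_sem_fail_While[OF Suc.prems, of E P S]
    by (intro add_left_mono) simp
qed simp

lemma incseq_while_iter:
  assumes "sets M = UNIV"
  shows "incseq (\<lambda>k. emeasure (while_iter E P k M) S)"
proof (rule incseq_SucI)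
  fix k show "emeasure (while_iter E P k M) S \<le> emeasure (while_iter E P (Suc k) M) S"
    using assms
  proof (induction k arbitrary: M)
    case (Suc k)
    show ?case
      unfolding emeasure_while_iter_Suc[OF Suc.prems]
      by (intro add_left_mono Suc.IH) (simp add: Suc.prems)
  qed simp
qed

text \<open>The setwise supremum \<open>\<psi>\<close> of the iterates is a measure, since
  increasing suprema commute with countable sums. The functional evaluates \<open>\<psi>\<close> at
  an argument independent of \<open>\<psi>\<close>, so the supremum passes through it and
  \<open>\<psi>\<close> is a prefixed point, hence above the least one.\<close>

lemma sem_fail_While_le_SUP:
  assumes "sets M = UNIV"
  shows "emeasure (sem_fail (While E P) M) S \<le> (SUP k. emeasure (while_iter E P k M) S)"
proof -
  define \<psi> where "\<psi> M = discrete_measure (\<lambda>S. SUP k. emeasure (while_iter E P k M) S)" for M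
  have \<psi>: "emeasure (\<psi> M) S = (SUP k. emeasure (while_iter E P k M) S)" if "sets M = UNIV" for M S
    unfolding \<psi>_def
  proof (rule emeasure_discrete_measure)
    show "countably_additive UNIV (\<lambda>S. SUP k. emeasure (while_iter E P k M) S)"
    proof (rule countably_additiveI)
      fix A :: "nat \<Rightarrow> 'a state set"
      assume A: "disjoint_family A"
      have "(\<Sum>i. SUP k. emeasure (while_iter E P k M) (A i)) =
          (SUP k. \<Sum>i. emeasure (while_iter E P k M) (A i))"
        using that by (intro ennreal_suminf_SUP_eq incseq_while_iter)
      also have "\<dots> = (SUP k. emeasure (while_iter E P k M) (\<Union>i. A i))"
        using A by (subst suminf_emeasure) auto
      finally show "(\<Sum>i. SUP k. emeasure (while_iter E P k M) (A i)) =
          (SUP k. emeasure (while_iter E P k M) (\<Union>i. A i))" .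
    qed
  qed simp
  have [simp]: "sets (\<psi> M) = UNIV" for M
    by (simp add: \<psi>_def)
  have "sem_fail (While E P) M \<preceq> \<psi> M"
  proof (rule sem_fail_While_least)
    fix M :: "'a state measure"
    assume M: "sets M = UNIV"
    show "while_functional E (sem_fail P) \<psi> M \<preceq> \<psi> M"
      unfolding measure_preceq_def
    proof
      fix S
      have "emeasure (while_functional E (sem_fail P) \<psi> M) S =
          (SUP k. emeasure (while_iter E P (Suc k) M) S)"
        using M unfolding emeasure_while_iter_Suc[OF M]
        by (subst emeasure_while_functional)
          (auto simp: \<psi> ennreal_SUP_add_right simp del: restrict_event.simps)
      also have "\<dots> \<le> (SUP k. emeasure (while_iter E P k M) S)"
        by (rule SUP_mono) blast
      finally show "emeasure (while_functional E (sem_fail P) \<psi> M) S \<le> emeasure (\<psi> M) S"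
        by (simp add: \<psi> M)
    qed
  qed (use assms in simp_all)
  then show ?thesis
    using assms by (simp add: measure_preceq_def \<psi>)
qed

lemma emeasure_update_state_UNIV:
  "sets M = UNIV \<Longrightarrow> emeasure (update_state f M) UNIV = emeasure M UNIV"
  by (simp add: emeasure_update_state emeasure_restrict_to emeasure_split_fail[of M UNIV] full_SetCompr_eq)

section \<open>Total mass and the lower bound semantics\<close>

text \<open>Programs create no mass. For a loop this is shown for every iterate, where the body
  passes on at most the mass it received, and carries over to the supremum.\<close>

lemma sem_fail_mass_le:
  fixes M :: "('n::finite) state measure"
  assumes "sets M = UNIV" "emeasure M UNIV < \<top>"
  shows "emeasure (sem_fail P M) UNIV \<le> emeasure M UNIV"
  using assms
proof (induction P arbitrary: M)
  case (Seq P1 P2)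
  have "emeasure (sem_fail P2 (sem_fail P1 M)) UNIV \<le> emeasure (sem_fail P1 M) UNIV"
    using Seq.prems Seq.IH(1)[OF Seq.prems] by (intro Seq.IH) (auto intro: le_less_trans)
  also have "\<dots> \<le> emeasure M UNIV"
    by (rule Seq.IH(1)[OF Seq.prems])
  finally show ?case by simp
next
  case (SetZero k)
  then show ?case
    by (simp add: emeasure_update_state_UNIV)
next
  case (Incr k a)
  then show ?case
    by (simp add: emeasure_update_state_UNIV)
next
  case (Decr k)
  then show ?case
    by (simp add: emeasure_update_state_UNIV)
next
  case (IfElse E P1 P2)
  note M = IfElse.prems(1) emeasure_range_Some_finite[OF IfElse.prems]
  show ?case
    unfolding emeasure_sem_fail_IfElse[OF M(1)] emeasure_split_event[OF M, of UNIV E]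
    by (intro add_mono order_refl IfElse.IH)
      (simp_all add: M emeasure_restrict_event_finite del: restrict_event.simps)
next
  case (While E P)
  have "emeasure (while_iter E P k M) UNIV \<le> emeasure M UNIV" for k
    using While.prems
  proof (induction k arbitrary: M)
    case (Suc k)
    note M = Suc.prems(1) emeasure_range_Some_finite[OF Suc.prems]
    have E: "emeasure (restrict_event M E) UNIV < \<top>"
      using M by (rule emeasure_restrict_event_finite)
    have N: "emeasure (sem_fail P (restrict_event M E)) UNIV \<le> emeasure (restrict_event M E) UNIV"
      using M E by (intro While.IH) auto
    then have "emeasure (while_iter E P k (sem_fail P (restrict_event M E))) UNIV
        \<le> emeasure (sem_fail P (restrict_event M E)) UNIV"
      using M E by (intro Suc.IH) (auto intro: le_less_trans)
    also note N
    finally show ?case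
      unfolding emeasure_while_iter_Suc[OF M(1)] emeasure_split_event[OF M, of UNIV E]
      by (simp add: add_mono ac_simps del: restrict_event.simps)
  qed simp
  then show ?case
    using While.prems by (intro order_trans[OF sem_fail_While_le_SUP] SUP_least)
qed simp_all

text \<open>Two inputs, because in a sequence the second program starts from different measures: the
  lower semantics has dropped the loops of the first. A loop itself is trivial, as \<open>0\<close>
  is below everything.\<close>

lemma sem_lo_preceq_sem_fail:
  fixes M N :: "('n::finite) state measure"
  assumes "sets M = UNIV" "sets N = UNIV" "M \<preceq> N" "emeasure N UNIV < \<top>"
  shows "sem_lo P M \<preceq> sem_fail P N"
  using assms
proof (induction P arbitrary: M N)
  case (Seq P1 P2)
  then show ?case
    using sem_fail_mass_le[of N P1] by (auto intro: le_less_trans)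
next
  case (SetZero k)
  then show ?case
    by (auto simp: measure_preceq_def emeasure_update_state emeasure_restrict_to intro: add_mono)
next
  case (Incr k a)
  then show ?case
    by (auto simp: measure_preceq_def emeasure_update_state emeasure_restrict_to intro: add_mono)
next
  case (Decr k)
  then show ?case
    by (auto simp: measure_preceq_def emeasure_update_state emeasure_restrict_to intro: add_mono)
next
  case (IfElse E P1 P2)
  note N = IfElse.prems(2) emeasure_range_Some_finite[OF IfElse.prems(2,4)]
  have le: "restrict_event M F \<preceq> restrict_event N F" for F
    using IfElse.prems N by (intro restrict_event_mono)
  have "sem_lo P1 (restrict_event M E) \<preceq> sem_fail P1 (restrict_event N E)"
    "sem_lo P2 (restrict_event M (Neg E)) \<preceq> sem_fail P2 (restrict_event N (Neg E))"
    using IfElse.prems le N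
    by (intro IfElse.IH; simp add: emeasure_restrict_event_finite del: restrict_event.simps)+
  then show ?case
    using IfElse.prems(3) unfolding measure_preceq_def emeasure_sem_lo_IfElse[OF IfElse.prems(1)]
      emeasure_sem_fail_IfElse[OF IfElse.prems(2)]
    by (intro allI add_mono) blast+
next
  case Fail
  then show ?case
    by (auto simp: measure_preceq_def intro: mult_right_mono)
qed (simp_all add: measure_preceq_def)

section \<open>Soundness of the geometric bounds\<close>

text \<open>
  The factor \<open>t\<close> builds the homogeneity of the semantics into the induction: a loop invariant
  \<open>R\<close> with contraction factor \<open>c\<close> bounds the measure entering the \<open>k\<close>-th iteration by \<open>t * c ^ k\<close>
  times \<open>R\<close>. Failure mass is not bounded.
\<close>

definition egd_bounds :: "real \<Rightarrow> 'n egd \<Rightarrow> 'n state measure \<Rightarrow> bool" where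
  "egd_bounds t p M \<longleftrightarrow> 0 \<le> t \<and> sets M = UNIV \<and>
     (\<forall>x. emeasure M {Some x} \<le> ennreal (t * egd_mass p x))"

lemma egd_boundsD:
  assumes "egd_bounds t p M"
  shows "0 \<le> t" "sets M = UNIV" "emeasure M {Some x} \<le> ennreal (t * egd_mass p x)"
  using assms by (auto simp: egd_bounds_def)

text \<open>The bound on sets serves for assignments, whose preimages can be infinite, and for total
  mass.\<close>

lemma egd_bounds_emeasure:
  fixes p :: "('n::finite) egd"
  assumes "egd_bounds t p M"
  shows "emeasure M (Some ` A) \<le> ennreal t * emeasure (egd_measure p) A"
proof -
  have "on_nat M \<preceq> scale_measure (ennreal t) (emb (egd_measure p))"
  proof (rule preceq_pointwise)
    fix s show "emeasure (on_nat M) {s} \<le> emeasure (scale_measure (ennreal t) (emb (egd_measure p))) {s}"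
    proof (cases s)
      case None
      then show ?thesis
        using egd_boundsD(2)[OF assms] by (simp add: emeasure_restrict_to)
    next
      case (Some x)
      have "range Some \<inter> {Some x} = {Some x}"
        by auto
      then show ?thesis
        using egd_boundsD[OF assms] Some
        by (simp add: emeasure_restrict_to emeasure_emb_egd_measure flip: ennreal_mult')
    qed
  qed (use egd_boundsD(2)[OF assms] in auto)
  moreover have "range Some \<inter> Some ` A = Some ` A" "{x. Some x \<in> Some ` A} = A"
    by auto
  ultimately show ?thesis
    using egd_boundsD(2)[OF assms]
    unfolding measure_preceq_def by (auto simp: emeasure_restrict_to emeasure_emb dest!: spec[of _ "Some ` A"])
qed

lemma egd_bounds_finite:
  fixes p :: "('n::finite) egd"
  assumes "egd_bounds t p M" "is_egd p"
  shows "emeasure M (range Some) < \<top>"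
  using egd_bounds_emeasure[OF assms(1), of UNIV] emeasure_egd_measure_finite[OF assms(2)]
  by (auto simp: ennreal_mult_less_top elim!: le_less_trans)

lemma egd_bounds_restrict_event:
  fixes p :: "('n::finite) egd"
  assumes "egd_bounds t p M" "is_egd p"
  shows "egd_bounds t (geo_event p E) (restrict_event M E)"
  unfolding egd_bounds_def
proof (intro conjI allI)
  fix x
  have "emeasure (restrict_event M E) {Some x} = ennreal (weight E x) * emeasure M {Some x}"
    using egd_boundsD(2)[OF assms(1)] egd_bounds_finite[OF assms] by (rule emeasure_restrict_event_Some)
  also have "\<dots> \<le> ennreal (weight E x) * ennreal (t * egd_mass p x)"
    using egd_boundsD(3)[OF assms(1)] by (intro mult_left_mono) auto
  also have "\<dots> = ennreal (t * egd_mass (geo_event p E) x)"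
    using weight_bounds[of E x]
    by (simp add: egd_mass_geo_event[OF assms(2)] ac_simps flip: ennreal_mult')
  finally show "emeasure (restrict_event M E) {Some x} \<le> ennreal (t * egd_mass (geo_event p E) x)" .
qed (use egd_boundsD[OF assms(1)] in auto)

lemma egd_bounds_mono:
  assumes "egd_bounds t p M" and "\<And>x. t * egd_mass p x \<le> t' * egd_mass q x" and "0 \<le> t'"
  shows "egd_bounds t' q M"
  using assms unfolding egd_bounds_def by (meson ennreal_leI order_trans)

lemma egd_bounds_update_state:
  fixes p :: "('n::finite) egd"
  assumes "egd_bounds t p M"
    and "\<And>y. emeasure (egd_measure p) {x. f x = y} = ennreal (egd_mass q y)"
  shows "egd_bounds t q (update_state f M)"
  unfolding egd_bounds_def
proof (intro conjI allI)
  fix y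
  have "{Some x |x. Some (f x) \<in> {Some y}} = Some ` {x. f x = y}"
    by auto
  then have "emeasure (update_state f M) {Some y} = emeasure M (Some ` {x. f x = y})"
    using egd_boundsD(2)[OF assms(1)] by (simp add: emeasure_update_state emeasure_restrict_to)
  also have "\<dots> \<le> ennreal t * ennreal (egd_mass q y)"
    using egd_bounds_emeasure[OF assms(1), of "{x. f x = y}"] by (simp add: assms(2))
  finally show "emeasure (update_state f M) {Some y} \<le> ennreal (t * egd_mass q y)"
    using egd_boundsD(1)[OF assms(1)] by (simp add: ennreal_mult')
qed (use egd_boundsD[OF assms(1)] in auto)

text \<open>One round of the loop contracts the bound by \<open>c\<close>. The body is an abstract
  \<open>f\<close>, whose soundness is the induction hypothesis in one application and
  \<open>geo_sem_egd_bounds\<close> in the other.\<close>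

lemma egd_bounds_loop_body:
  fixes s :: "('n::finite) egd"
  assumes "egd_bounds t (EGD R \<gamma>) M" "is_egd (EGD R \<gamma>)" "is_egd s" "0 \<le> c"
    and "\<And>M. egd_bounds t (geo_event (EGD R \<gamma>) E) M \<Longrightarrow> egd_bounds t s (f M)"
    and "s \<preceq>\<^sub>E\<^sub>G\<^sub>D EGD (scale_tensor c R) \<gamma>"
  shows "egd_bounds (t * c) (EGD R \<gamma>) (f (restrict_event M E))"
proof (rule egd_bounds_mono)
  show "egd_bounds t s (f (restrict_event M E))"
    by (intro assms(5) egd_bounds_restrict_event assms(1,2))
  have t: "0 \<le> t"
    using assms(1) by (rule egd_boundsD)
  then show "0 \<le> t * c"
    using assms(4) by simp
  show "t * egd_mass s x \<le> t * c * egd_mass (EGD R \<gamma>) x" for x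
    using egd_le_mass[OF assms(3,6), of x] t
    unfolding egd_mass_scale by (simp add: mult.assoc mult_left_mono del: egd_mass.simps)
qed

text \<open>Assignments are exact and branches use \<open>egd_join_mass\<close>; the work is in
  loops, where a bound common to all iterates carries over to the supremum.\<close>

lemma geo_sem_egd_bounds:
  fixes p :: "('n::finite) egd"
  assumes "geo_sem C p q" "is_egd p" "egd_bounds t p M"
  shows "egd_bounds t q (sem_fail C M)"
  using assms
proof (induction C arbitrary: p q t M)
  case (Seq C1 C2)
  then show ?case by auto
next
  case (SetZero k)
  show ?case
    unfolding sem_fail.simps using SetZero.prems
    by (intro egd_bounds_update_state geo_sem_SetZero_mass)
next
  case (Incr k a)
  show ?case
    unfolding sem_fail.simps using Incr.prems
    by (intro egd_bounds_update_state geo_sem_Incr_mass)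
next
  case (Decr k)
  show ?case
    unfolding sem_fail.simps using Decr.prems
    by (intro egd_bounds_update_state geo_sem_Decr_mass)
next
  case (IfElse E C1 C2)
  note M = egd_boundsD[OF IfElse.prems(3)]
  from IfElse.prems(1) obtain r s where rs: "is_egd r" "is_egd s"
    "geo_sem C1 (geo_event p E) r" "geo_sem C2 (geo_event p (Neg E)) s" "egd_join r s q"
    by (auto simp del: geo_event.simps)
  note 1 = egd_boundsD[OF IfElse.IH(1)[OF rs(3) is_egd_geo_event[OF IfElse.prems(2)]
      egd_bounds_restrict_event[OF IfElse.prems(3,2)]]]
  note 2 = egd_boundsD[OF IfElse.IH(2)[OF rs(4) is_egd_geo_event[OF IfElse.prems(2)]
      egd_bounds_restrict_event[OF IfElse.prems(3,2)]]]
  show ?case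
    unfolding egd_bounds_def
  proof (intro conjI allI)
    fix x
    have "emeasure (sem_fail (IfElse E C1 C2) M) {Some x} =
        emeasure (sem_fail C1 (restrict_event M E)) {Some x}
        + emeasure (sem_fail C2 (restrict_event M (Neg E))) {Some x}"
      unfolding emeasure_sem_fail_IfElse[OF M(2)] by simp
    also have "\<dots> \<le> ennreal (t * egd_mass r x) + ennreal (t * egd_mass s x)"
      by (intro add_mono 1 2)
    also have "\<dots> = ennreal (t * (egd_mass r x + egd_mass s x))"
      using M(1) rs(1,2) by (simp add: egd_mass_nonneg distrib_left)
    also have "\<dots> \<le> ennreal (t * egd_mass q x)"
      using M(1) rs by (intro ennreal_leI mult_left_mono egd_join_mass)
    finally show "emeasure (sem_fail (IfElse E C1 C2) M) {Some x} \<le> ennreal (t * egd_mass q x)" .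
  qed (use M in auto)
next
  case (While E C)
  from While.prems(1) obtain c R \<gamma> s where c: "0 \<le> c" "c < 1" and R: "is_egd (EGD R \<gamma>)"
    and s: "is_egd s" and pR: "p \<preceq>\<^sub>E\<^sub>G\<^sub>D EGD R \<gamma>" and Cs: "geo_sem C (geo_event (EGD R \<gamma>) E) s"
    and sR: "s \<preceq>\<^sub>E\<^sub>G\<^sub>D EGD (scale_tensor c R) \<gamma>"
    and q: "geo_event (EGD (scale_tensor (1 / (1 - c)) R) \<gamma>) (Neg E) = q"
    unfolding geo_sem.simps by blast
  have mass_q: "egd_mass q x = weight (Neg E) x * egd_mass (EGD R \<gamma>) x / (1 - c)" for x
  proof -
    have "is_egd (EGD (scale_tensor (1 / (1 - c)) R) \<gamma>)"
      using R c by (auto simp: is_egd_def)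
    then show ?thesis
      unfolding q[symmetric] by (subst egd_mass_geo_event) (simp_all only: egd_mass_scale, simp)
  qed
  have MR: "egd_bounds t (EGD R \<gamma>) M"
    using While.prems(3) egd_boundsD(1)[OF While.prems(3)] egd_le_mass[OF While.prems(2) pR]
    by (intro egd_bounds_mono[OF While.prems(3)] mult_left_mono)
  \<comment> \<open>\<open>t\<close> and \<open>M\<close> are general, since the remaining
    unrollings start from a measure bounded with the factor \<open>t * c\<close>.\<close>
  have iter: "emeasure (while_iter E C k M) {Some x} \<le> ennreal (t * egd_mass q x)"
    if "egd_bounds t (EGD R \<gamma>) M" for k x t M
    using that
  proof (induction k arbitrary: t M)
    case (Suc k)
    note M = egd_boundsD[OF Suc.prems]
    let ?w = "weight (Neg E) x" and ?m = "egd_mass (EGD R \<gamma>) x"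
    have nonneg: "0 \<le> ?w" "0 \<le> ?m"
      by (rule weight_bounds, rule egd_mass_nonneg[OF R])
    have "egd_bounds (t * c) (EGD R \<gamma>) (sem_fail C (restrict_event M E))"
      using Suc.prems R s c(1) _ sR
    proof (rule egd_bounds_loop_body)
      fix N assume "egd_bounds t (geo_event (EGD R \<gamma>) E) N"
      with Cs is_egd_geo_event[OF R] show "egd_bounds t s (sem_fail C N)"
        by (rule While.IH)
    qed
    then have "emeasure (while_iter E C k (sem_fail C (restrict_event M E))) {Some x}
        \<le> ennreal (t * c * egd_mass q x)"
      by (rule Suc.IH)
    moreover have "emeasure (restrict_event M (Neg E)) {Some x} \<le> ennreal (t * (?w * ?m))"
      using egd_boundsD(3)[OF egd_bounds_restrict_event[OF Suc.prems R, of "Neg E"], of x]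
      unfolding egd_mass_geo_event[OF R] .
    ultimately have "emeasure (while_iter E C (Suc k) M) {Some x} \<le>
        ennreal (t * (?w * ?m)) + ennreal (t * c * egd_mass q x)"
      unfolding emeasure_while_iter_Suc[OF M(2)]
      by (simp add: add_mono del: restrict_event.simps weight.simps egd_mass.simps)
    also have "\<dots> = ennreal (t * (?w * ?m) + t * c * egd_mass q x)"
      unfolding mass_q using nonneg M(1) c
      by (intro ennreal_plus[symmetric] mult_nonneg_nonneg divide_nonneg_nonneg) auto
    \<comment> \<open>With \<open>q = w * m / (1 - c)\<close> this is the equation
      \<open>q = w * m + c * q\<close> of the geometric series.\<close>
    also have "t * (?w * ?m) + t * c * egd_mass q x = t * egd_mass q x"
      unfolding mass_q using c by (simp add: field_simps del: weight.simps egd_mass.simps)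
    finally show ?case .
  qed simp
  show ?case
    unfolding egd_bounds_def
  proof (intro conjI allI)
    fix x show "emeasure (sem_fail (While E C) M) {Some x} \<le> ennreal (t * egd_mass q x)"
      by (rule order_trans[OF sem_fail_While_le_SUP[OF egd_boundsD(2)[OF MR]]])
        (intro SUP_least iter MR)
  qed (use egd_boundsD[OF MR] in auto)
next
  case Fail
  then show ?case
    by (auto simp: egd_bounds_def entry_tensor)
qed simp

text \<open>
  A program with a geometric bound terminates almost surely, since the mass remaining in a loop
  decays like \<open>c ^ k\<close>. This is what makes the lower bound on the normalized measure correct.
\<close>

lemma geo_sem_mass_ge:
  fixes p :: "('n::finite) egd"
  assumes "geo_sem C p q" "is_egd p" "egd_bounds t p M"
  shows "emeasure M UNIV \<le> emeasure (sem_fail C M) UNIV"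
  using assms
proof (induction C arbitrary: p q t M)
  case (Seq C1 C2)
  from Seq.prems(1) obtain r where r: "is_egd r" "geo_sem C1 p r" "geo_sem C2 r q"
    by auto
  have "emeasure M UNIV \<le> emeasure (sem_fail C1 M) UNIV"
    by (rule Seq.IH(1)[OF r(2) Seq.prems(2,3)])
  also have "\<dots> \<le> emeasure (sem_fail C2 (sem_fail C1 M)) UNIV"
    by (rule Seq.IH(2)[OF r(3,1) geo_sem_egd_bounds[OF r(2) Seq.prems(2,3)]])
  finally show ?case by simp
next
  case (IfElse E C1 C2)
  note M = egd_boundsD(2)[OF IfElse.prems(3)] egd_bounds_finite[OF IfElse.prems(3,2)]
  from IfElse.prems(1) obtain r s where rs:
    "geo_sem C1 (geo_event p E) r" "geo_sem C2 (geo_event p (Neg E)) s"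
    by (auto simp del: geo_event.simps)
  show ?case
    unfolding emeasure_sem_fail_IfElse[OF M(1)] emeasure_split_event[OF M, of UNIV E]
    using IfElse.prems(2,3)
    by (intro add_mono order_refl IfElse.IH(1)[OF rs(1)] IfElse.IH(2)[OF rs(2)]
        is_egd_geo_event egd_bounds_restrict_event)
next
  case (While E C)
  from While.prems(1) obtain c R \<gamma> s where c: "0 \<le> c" "c < 1" and R: "is_egd (EGD R \<gamma>)"
    and s: "is_egd s" and pR: "p \<preceq>\<^sub>E\<^sub>G\<^sub>D EGD R \<gamma>" and Cs: "geo_sem C (geo_event (EGD R \<gamma>) E) s"
    and sR: "s \<preceq>\<^sub>E\<^sub>G\<^sub>D EGD (scale_tensor c R) \<gamma>"
    unfolding geo_sem.simps by blast
  have MR: "egd_bounds t (EGD R \<gamma>) M"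
    using While.prems(3) egd_boundsD(1)[OF While.prems(3)] egd_le_mass[OF While.prems(2) pR]
    by (intro egd_bounds_mono[OF While.prems(3)] mult_left_mono)
  obtain K where K: "emeasure (egd_measure (EGD R \<gamma>)) UNIV = ennreal K" "0 \<le> K"
    using emeasure_egd_measure_finite[OF R] by (auto simp: less_top_ennreal)
  \<comment> \<open>What the iterate misses is the mass that enters the body once more after
    \<open>k\<close> rounds; the invariant bounds it by \<open>t * c ^ k\<close> times its total
    mass \<open>K\<close>.\<close>
  have iter: "emeasure M UNIV \<le> emeasure (while_iter E C (Suc k) M) UNIV + ennreal (t * c ^ k * K)"
    if "egd_bounds t (EGD R \<gamma>) M" for k t M
    using that
  proof (induction k arbitrary: t M)
    case 0
    note M = egd_boundsD(2)[OF 0] egd_bounds_finite[OF 0 R]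
    have "emeasure (restrict_event M E) UNIV \<le> emeasure M (range Some)"
      using restrict_event_preceq_on_nat[OF M, of E] M
      by (simp add: measure_preceq_def emeasure_restrict_to)
        (metis Int_UNIV_right)
    also have "\<dots> \<le> ennreal (t * K)"
      using egd_bounds_emeasure[OF 0, of UNIV] K egd_boundsD(1)[OF 0] by (simp add: ennreal_mult)
    finally show ?case
      unfolding emeasure_while_iter_Suc[OF M(1)] emeasure_split_event[OF M, of UNIV E]
      by (simp add: add_mono ac_simps del: restrict_event.simps)
  next
    case (Suc k)
    note M = egd_boundsD(2)[OF Suc.prems] egd_bounds_finite[OF Suc.prems R]
    let ?N = "sem_fail C (restrict_event M E)"
    have "egd_bounds (t * c) (EGD R \<gamma>) ?N"
      using Suc.prems R s c(1) _ sR
    proof (rule egd_bounds_loop_body)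
      fix N assume "egd_bounds t (geo_event (EGD R \<gamma>) E) N"
      with Cs is_egd_geo_event[OF R] show "egd_bounds t s (sem_fail C N)"
        by (rule geo_sem_egd_bounds)
    qed
    from Suc.IH[OF this] have N: "emeasure ?N UNIV \<le>
        emeasure (while_iter E C (Suc k) ?N) UNIV + ennreal (t * c ^ Suc k * K)"
      by (simp add: mult.assoc del: while_iter.simps)
    \<comment> \<open>The body itself loses no mass, by the outer induction hypothesis.\<close>
    have "emeasure (restrict_event M E) UNIV \<le> emeasure ?N UNIV"
      by (rule While.IH[OF Cs is_egd_geo_event[OF R] egd_bounds_restrict_event[OF Suc.prems R]])
    also note N
    finally have "emeasure M (UNIV \<inter> {None}) + emeasure (restrict_event M (Neg E)) UNIV
        + emeasure (restrict_event M E) UNIV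
      \<le> emeasure M (UNIV \<inter> {None}) + emeasure (restrict_event M (Neg E)) UNIV
        + (emeasure (while_iter E C (Suc k) ?N) UNIV + ennreal (t * c ^ Suc k * K))"
      by (rule add_left_mono)
    then show ?case
      unfolding emeasure_while_iter_Suc[OF M(1), of _ _ "Suc k"] emeasure_split_event[OF M, of UNIV E]
      by (simp only: ac_simps)
  qed
  let ?W = "emeasure (sem_fail (While E C) M) UNIV"
  have "emeasure M UNIV \<le> ?W + ennreal (t * c ^ k * K)" for k
    using iter[OF MR, of k] while_iter_preceq_sem_fail[OF egd_boundsD(2)[OF MR], of E C "Suc k" UNIV]
    by (meson add_right_mono order_trans)
  \<comment> \<open>The mass still running vanishes as \<open>k\<close> grows; the limit keeps the
    form \<open>t * 0 * K\<close> to match the limit rules.\<close>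
  moreover have "(\<lambda>k. ?W + ennreal (t * c ^ k * K)) \<longlonglongrightarrow> ?W + ennreal (t * 0 * K)"
    using c by (intro tendsto_add tendsto_const tendsto_ennrealI tendsto_mult LIMSEQ_realpow_zero)
  ultimately have "emeasure M UNIV \<le> ?W + ennreal (t * 0 * K)"
    by (intro LIMSEQ_le_const) auto
  then show ?case by simp
next
  case Fail
  then show ?case
    by simp
qed (simp_all only: sem_fail.simps emeasure_update_state_UNIV[OF egd_boundsD(2)] order_refl)

section \<open>Normalization and assembly of the claims\<close>

lemma one_divide_antimono_ennreal:
  assumes "0 < a" "a \<le> b"
  shows "1 / b \<le> 1 / (a :: ennreal)"
proof (cases "b = \<top>")
  case False
  then obtain r s where "a = ennreal r" "b = ennreal s" "0 \<le> r" "0 \<le> s"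
    using assms by (metis ennreal_cases top.extremum_unique)
  with assms show ?thesis
    by (simp add: divide_ennreal frac_le flip: ennreal_1)
qed simp

theorem theorem4p13:
  fixes P :: "'n::finite tensor" and \<alpha> :: "'n \<Rightarrow> real"
  assumes "is_egd (EGD P \<alpha>)"
  shows
    "(\<forall>E. emb (egd_measure (geo_event (EGD P \<alpha>) E)) =
            restrict_event (emb (egd_measure (EGD P \<alpha>))) E) \<and>
     (\<forall>C Q \<beta>. is_egd (EGD Q \<beta>) \<longrightarrow> geo_sem C (EGD P \<alpha>) (EGD Q \<beta>) \<longrightarrow>
        sem C (egd_measure (EGD P \<alpha>)) \<preceq> emb (egd_measure (EGD Q \<beta>))) \<and>
     (\<forall>C Q \<beta>. is_egd (EGD Q \<beta>) \<longrightarrow> geo_sem C (EGD P \<alpha>) (EGD Q \<beta>) \<longrightarrow>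
        prob_space (egd_measure (EGD P \<alpha>)) \<longrightarrow>
        (let \<mu> = emb (egd_measure (EGD P \<alpha>));
             \<nu> = emb (egd_measure (EGD Q \<beta>))
         in 0 < 1 - emeasure (sem_fail C \<mu>) {None} \<longrightarrow>
            (0 < emeasure \<nu> (range Some) \<longrightarrow>
               scale_measure (1 / emeasure \<nu> (range Some)) (on_nat (sem_lo C \<mu>))
                 \<preceq> normalize_measure (sem_fail C \<mu>)) \<and>
            (0 < emeasure (sem_lo C \<mu>) (range Some) \<longrightarrow>
               normalize_measure (sem_fail C \<mu>)
                 \<preceq> scale_measure (1 / emeasure (sem_lo C \<mu>) (range Some)) \<nu>)))"
proof -
  define \<mu> where "\<mu> = emb (egd_measure (EGD P \<alpha>))"
  have sets_\<mu>: "sets \<mu> = UNIV"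
    by (simp add: \<mu>_def)
  have \<mu>_egd: "emeasure \<mu> UNIV = emeasure (egd_measure (EGD P \<alpha>)) UNIV"
    by (simp add: \<mu>_def emeasure_emb)
  then have fin: "emeasure \<mu> UNIV < \<top>"
    using emeasure_egd_measure_finite[OF assms] by simp
  \<comment> \<open>The input is its own bound, with factor \<open>1\<close>; the soundness and mass
    lemmas are applied from here.\<close>
  have bounds: "egd_bounds 1 (EGD P \<alpha>) \<mu>"
    by (simp add: egd_bounds_def \<mu>_def emeasure_emb_egd_measure)
  have event: "emb (egd_measure (geo_event (EGD P \<alpha>) E)) = restrict_event \<mu> E" for E
  proof (rule discrete_eqI)
    fix s show "emeasure (emb (egd_measure (geo_event (EGD P \<alpha>) E))) {s} = emeasure (restrict_event \<mu> E) {s}"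
      using sets_\<mu> emeasure_range_Some_finite[OF sets_\<mu> fin] weight_bounds(1)[of E]
      by (cases s)
        (simp_all add: emeasure_restrict_event_None emeasure_restrict_event_Some
          emeasure_emb_egd_measure egd_mass_geo_event[OF assms] ennreal_mult' \<mu>_def del: egd_mass.simps)
  qed (simp_all add: sets_\<mu>)
  have upper: "on_nat (sem_fail C \<mu>) \<preceq> emb (egd_measure q)" if "geo_sem C (EGD P \<alpha>) q" for C q
  proof (rule preceq_pointwise)
    fix s show "emeasure (on_nat (sem_fail C \<mu>)) {s} \<le> emeasure (emb (egd_measure q)) {s}"
    proof (cases s)
      case (Some x)
      have "range Some \<inter> {Some x} = {Some x}"
        by auto
      then show ?thesis
        using egd_boundsD(3)[OF geo_sem_egd_bounds[OF that assms bounds], of x] Some sets_\<mu>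
        by (simp add: emeasure_restrict_to emeasure_emb_egd_measure)
    qed (simp add: emeasure_restrict_to sets_\<mu>)
  qed (simp_all add: sets_\<mu>)
  have normalized:
    "(0 < emeasure \<nu> (range Some) \<longrightarrow>
        scale_measure (1 / emeasure \<nu> (range Some)) (on_nat (sem_lo C \<mu>)) \<preceq> normalize_measure (sem_fail C \<mu>)) \<and>
     (0 < emeasure (sem_lo C \<mu>) (range Some) \<longrightarrow>
        normalize_measure (sem_fail C \<mu>) \<preceq> scale_measure (1 / emeasure (sem_lo C \<mu>) (range Some)) \<nu>)"
    if "geo_sem C (EGD P \<alpha>) q" "prob_space (egd_measure (EGD P \<alpha>))"
      "0 < 1 - emeasure (sem_fail C \<mu>) {None}" and \<nu>: "\<nu> = emb (egd_measure q)" for C q \<nu>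
  proof -
    let ?F = "sem_fail C \<mu>" and ?L = "sem_lo C \<mu>"
    have sets_F: "sets ?F = UNIV" and sets_L: "sets ?L = UNIV"
      using sets_\<mu> by auto
    have "emeasure \<mu> UNIV = 1"
      using prob_space.emeasure_space_1[OF that(2)] by (simp add: \<mu>_egd discrete_space)
    \<comment> \<open>No mass is created and, given the geometric bound, none diverges. So failing
      and non-failing mass are complementary, which identifies the denominator.\<close>
    then have F1: "emeasure ?F UNIV = 1"
      using sem_fail_mass_le[OF sets_\<mu> fin, of C] geo_sem_mass_ge[OF that(1) assms bounds] by simp
    then have split: "emeasure ?F {None} + emeasure ?F (range Some) = 1"
      using emeasure_split_fail[OF sets_F, of UNIV] by simp
    then have "emeasure ?F {None} \<noteq> \<top>"
      by auto
    then have denom: "1 - emeasure ?F {None} = emeasure ?F (range Some)"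
      using split by (metis ennreal_add_diff_cancel_left)
    have fin_F: "finite_measure ?F" and fin_F': "finite_measure (on_fail ?F)"
      using F1 sets_F split
      by (auto intro!: finite_measure_discrete simp: emeasure_restrict_to \<open>emeasure ?F {None} \<noteq> \<top>\<close> top.not_eq_extremum[symmetric])
    have norm: "emeasure (normalize_measure ?F) S =
        1 / emeasure ?F (range Some) * emeasure ?F (range Some \<inter> S)" for S
    proof -
      have "emeasure (diff_measure ?F (on_fail ?F)) S = emeasure ?F S - emeasure ?F ({None} \<inter> S)"
        using sets_F fin_F fin_F'
        by (subst emeasure_diff_measure) (auto simp: emeasure_restrict_to intro!: emeasure_mono)
      also have "\<dots> = emeasure ?F (range Some \<inter> S)"
        using emeasure_split_fail[OF sets_F, of S] finite_measure.emeasure_finite[OF fin_F, of "{None} \<inter> S"]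
        by (simp add: Int_commute)
      finally show ?thesis
        by (simp add: normalize_measure_def denom)
    qed
    have LF: "emeasure ?L S \<le> emeasure ?F S" for S
      using sem_lo_preceq_sem_fail[OF sets_\<mu> sets_\<mu> _ fin, of C] by (simp add: measure_preceq_def)
    have F\<nu>: "emeasure ?F (range Some \<inter> S) \<le> emeasure \<nu> S" for S
      using upper[OF that(1)] sets_F by (simp add: measure_preceq_def \<nu> emeasure_restrict_to)
    have pos: "0 < emeasure ?F (range Some)"
      using that(3) denom by simp
    \<comment> \<open>Setwise, \<open>?L\<close> is below \<open>?F\<close>, whose non-failing part
      is below \<open>\<nu>\<close>. Reciprocals reverse this order, so each bound takes its
      denominator from the opposite end of the chain.\<close>
    show ?thesis
      unfolding measure_preceq_def
    proof (intro conjI impI allI)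
      fix S
      have "1 / emeasure \<nu> (range Some) \<le> 1 / emeasure ?F (range Some)"
        using F\<nu>[of "range Some"] pos by (intro one_divide_antimono_ennreal) auto
      then show "emeasure (scale_measure (1 / emeasure \<nu> (range Some)) (on_nat ?L)) S
          \<le> emeasure (normalize_measure ?F) S"
        using LF sets_L by (simp add: norm emeasure_restrict_to mult_mono)
    next
      fix S assume "0 < emeasure ?L (range Some)"
      then have "1 / emeasure ?F (range Some) \<le> 1 / emeasure ?L (range Some)"
        using LF by (intro one_divide_antimono_ennreal)
      then show "emeasure (normalize_measure ?F) S
          \<le> emeasure (scale_measure (1 / emeasure ?L (range Some)) \<nu>) S"
        using F\<nu> by (simp add: norm mult_mono)
    qed
  qed
  show ?thesis
    using event upper normalized unfolding sem_def Let_def \<mu>_def[symmetric] by blast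
qed

end
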